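(* Let $q\ge1$ (either $q=1$, or $q$ a prime power) and let $U$ be the set of all real vectors indexed by the vertices of $J_q(n,1)$ whose entries sum to zero. Then: (1) $U$ consists of the zero vector and all $\theta_1(J_q(n,1))$-eigenvectors of $J_q(n,1)$; (2) $W^T(U)$ consists of the zero vector and all $\theta_1(J_q(n,k))$-eigenvectors of $J_q(n,k)$; (3) if $S$ is a $q$-ary Steiner triple system of order $n$, then $W_S^T(U)$ consists of the zero vector and all $\theta_1(\Gamma_S)$-eigenvectors of its block graph $\Gamma_S$; (4) the restriction of each $\theta_1(J_q(n,3))$-eigenvector of $J_q(n,3)$ to the blocks of $S$ is a $\theta_1(\Gamma_S)$-eigenvector of $\Gamma_S$, and each $\theta_1(\Gamma_S)$-eigenvector of $\Gamma_S$ extends to a unique $\theta_1(J_q(n,3))$-eigenvector of $J_q(n,3)$; (5) if $S$ is a $q$-ary Steiner triple system of order $n$, then $m(1,\Gamma_S)\le m(1,J_q(n,3))$.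
   Context: For $q>1$ a prime power, the Grassmann graph $J_q(n,k)$ has as vertices the $k$-dimensional subspaces of $\mathbb F_q^n$, adjacent when they meet in a $(k-1)$-subspace; for $q=1$, $J_1(n,k)=J(n,k)$ is the Johnson graph on $k$-subsets of $\{1,\dots,n\}$, adjacent when they meet in a $(k-1)$-subset. "Points" are the $1$-subspaces (resp. $1$-subsets). $W$ is the incidence matrix with rows indexed by points and columns by vertices of $J_q(n,k)$, entry $1$ if the point is contained in the $k$-subspace (subset) and $0$ otherwise. Eigenvalues of a distance-regular graph are indexed in decreasing order $\theta_0>\theta_1>\dots$. A $q$-ary Steiner triple system (STS) of order $n$ is a collection $S$ of $3$-subspaces of $\mathbb F_q^n$ (3-subsets of $\{1,\dots,n\}$ if $q=1$), called blocks, such that each $2$-subspace ($2$-subset) lies in exactly one block; $W_S$ is the point–block incidence matrix (rows: points, columns: blocks of $S$). The block graph $\Gamma_S$ has the blocks as vertices, two distinct blocks adjacent iff they share a point; it is strongly regular with eigenvalues $\theta_0>\theta_1>\theta_2$. A $\theta$-eigenvector is a nonzero $v$ with $Av=\theta v$. NZI means all entries nonzero integers; $\|v\|_\infty=\max|v_x|$; $m(i,\Gamma)=\min\{\|u\|_\infty+1:u\text{ an NZI }\theta_i(\Gamma)\text{-eigenvector of }\Gamma\}$. *)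

theory Defs
  imports "HOL-Analysis.Analysis"
begin

text \<open>
  The two ambient geometries are functions \<open>G\<close> such that \<open>G k\<close> is the family of all
  \<open>k\<close>-subsets of \<open>{1..n}\<close> (the case \<open>q = 1\<close>) or of all \<open>k\<close>-subspaces of the space of
  \<open>n\<close>-tuples over the finite field \<open>'f\<close> (the case of a prime power \<open>q = CARD('f)\<close>,
  with \<open>n = CARD('n)\<close>).  In both cases containment is \<open>\<subseteq>\<close> and meet is \<open>\<inter>\<close>, so
  everything else is defined once for an arbitrary \<open>G\<close>.
\<close>

definition subsets :: "nat \<Rightarrow> nat \<Rightarrow> nat set set" where
  "subsets n k = {X. X \<subseteq> {1..n} \<and> card X = k}"

definition subspaces :: "nat \<Rightarrow> ('f::{field,finite} ^ 'n::finite) set set" where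
  "subspaces k = {X. vec.subspace X \<and> vec.dim X = k}"

record 'v graph =
  verts :: "'v set"
  adj :: "'v \<Rightarrow> 'v \<Rightarrow> bool"

text \<open>
  A real vector indexed by a set \<open>V\<close> is an element of \<open>extensional V\<close>; this makes vectors
  equal as soon as they agree on \<open>V\<close>, and restriction to a set of coordinates is \<open>restrict\<close>.
\<close>

definition zero_vec :: "'v set \<Rightarrow> 'v \<Rightarrow> real" where
  "zero_vec V = (\<lambda>x\<in>V. 0)"

definition adj_matrix :: "'v graph \<Rightarrow> 'v \<Rightarrow> 'v \<Rightarrow> real" where
  "adj_matrix \<Gamma> x y = (if adj \<Gamma> x y then 1 else 0)"

definition eigenvector :: "'v graph \<Rightarrow> real \<Rightarrow> ('v \<Rightarrow> real) \<Rightarrow> bool" where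
  "eigenvector \<Gamma> \<theta> v \<longleftrightarrow>
     v \<in> extensional (verts \<Gamma>) \<and> v \<noteq> zero_vec (verts \<Gamma>) \<and>
     (\<forall>x\<in>verts \<Gamma>. (\<Sum>y\<in>verts \<Gamma>. adj_matrix \<Gamma> x y * v y) = \<theta> * v x)"

definition eigenvalues :: "'v graph \<Rightarrow> real set" where
  "eigenvalues \<Gamma> = {\<theta>. \<exists>v. eigenvector \<Gamma> \<theta> v}"

text \<open>
  Distinct eigenvalues in decreasing order, counted from \<open>0\<close>; meaningful only for
  \<open>i < card (eigenvalues \<Gamma>)\<close>.
\<close>

definition theta :: "nat \<Rightarrow> 'v graph \<Rightarrow> real" where
  "theta i \<Gamma> = rev (sorted_list_of_set (eigenvalues \<Gamma>)) ! i"

definition J :: "(nat \<Rightarrow> 'a set set) \<Rightarrow> nat \<Rightarrow> 'a set graph" where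
  "J G k = \<lparr>verts = G k, adj = (\<lambda>X Y. X \<noteq> Y \<and> X \<inter> Y \<in> G (k - 1))\<rparr>"

definition points :: "(nat \<Rightarrow> 'a set set) \<Rightarrow> 'a set set" where
  "points G = G 1"

definition U :: "(nat \<Rightarrow> 'a set set) \<Rightarrow> ('a set \<Rightarrow> real) set" where
  "U G = {u \<in> extensional (verts (J G 1)). (\<Sum>x\<in>verts (J G 1). u x) = 0}"

definition incidence :: "'a set \<Rightarrow> 'a set \<Rightarrow> real" where
  "incidence p B = (if p \<subseteq> B then 1 else 0)"

text \<open>
  Multiplication by the transpose of the incidence matrix whose columns are indexed by \<open>\<B>\<close>:
  \<open>\<B> = G k\<close> gives \<open>W\<^sup>T\<close>, and the block set \<open>\<B> = S\<close> of a triple system gives \<open>W\<^sub>S\<^sup>T\<close>.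
\<close>

definition WT :: "(nat \<Rightarrow> 'a set set) \<Rightarrow> 'a set set \<Rightarrow> ('a set \<Rightarrow> real) \<Rightarrow> 'a set \<Rightarrow> real" where
  "WT G \<B> u = (\<lambda>B\<in>\<B>. \<Sum>p\<in>points G. incidence p B * u p)"

definition STS :: "(nat \<Rightarrow> 'a set set) \<Rightarrow> 'a set set \<Rightarrow> bool" where
  "STS G S \<longleftrightarrow> S \<subseteq> G 3 \<and> (\<forall>L\<in>G 2. \<exists>!B. B \<in> S \<and> L \<subseteq> B)"

definition block_graph :: "(nat \<Rightarrow> 'a set set) \<Rightarrow> 'a set set \<Rightarrow> 'a set graph" where
  "block_graph G S =
     \<lparr>verts = S, adj = (\<lambda>B C. B \<noteq> C \<and> (\<exists>p\<in>points G. p \<subseteq> B \<and> p \<subseteq> C))\<rparr>"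

definition NZI :: "'v set \<Rightarrow> ('v \<Rightarrow> real) \<Rightarrow> bool" where
  "NZI V v \<longleftrightarrow> (\<forall>x\<in>V. v x \<in> \<int> \<and> v x \<noteq> 0)"

definition sup_norm :: "'v set \<Rightarrow> ('v \<Rightarrow> real) \<Rightarrow> real" where
  "sup_norm V v = Max ((\<lambda>x. \<bar>v x\<bar>) ` V)"

text \<open>
  The values \<open>sup_norm u + 1\<close> of integer vectors are natural numbers, so the minimum is taken
  in \<open>nat\<close>; it is unspecified if there is no NZI eigenvector.
\<close>

definition m :: "nat \<Rightarrow> 'v graph \<Rightarrow> nat" where
  "m i \<Gamma> = (LEAST c. \<exists>u. eigenvector \<Gamma> (theta i \<Gamma>) u \<and> NZI (verts \<Gamma>) u \<and>
                         real c = sup_norm (verts \<Gamma>) u + 1)"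

end

theory Submission imports Defs begin

text \<open>
  Let \<open>M\<close> be the inclusion matrix between the \<open>k\<close>- and the \<open>(k+1)\<close>-subspaces (or subsets).
  Then \<open>M M\<^sup>T = A\<^sub>k + [n-k] I\<close> and \<open>M\<^sup>T M = A\<^sub>k\<^sub>+\<^sub>1 + [k+1] I\<close>, where \<open>A\<^sub>k\<close> is the
  adjacency matrix of \<open>J\<^sub>q(n,k)\<close> and \<open>[j] = 1 + q + \<dots> + q\<^sup>j\<^sup>-\<^sup>1\<close>.  Hence \<open>A\<^sub>k\<^sub>+\<^sub>1\<close>
  and \<open>A\<^sub>k\<close>, shifted by \<open>[n-k] - [k+1]\<close>, have the same eigenvalues apart from \<open>-[k+1]\<close>,
  and \<open>M\<^sup>T\<close> maps the eigenspaces for the other eigenvalues onto each other.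
  The exceptional value lies below the shifted \<open>\<theta>\<^sub>1\<close>, so induction from
  the complete graph \<open>J\<^sub>q(n,1)\<close> carries \<open>U\<close> to the \<open>\<theta>\<^sub>1\<close>-eigenspace of every \<open>J\<^sub>q(n,k)\<close>.
  The point-block matrix of a Steiner triple system satisfies equations of the same shape, in which
  \<open>[n-k]\<close> becomes the number of blocks through a point and \<open>[k+1]\<close> becomes \<open>[3]\<close>.
\<close>

section \<open>Transfer of eigenspaces along an incidence matrix\<close>

text \<open>Removing the maximum twice shows that the increasing list of eigenvalues ends in
  \<open>t, d\<close>, so its reverse starts with \<open>d, t\<close>. The remaining eigenvalues
  need only be bounded by \<open>t\<close>.\<close>

lemma theta_1_eqI:
  assumes fin: "finite (eigenvalues \<Gamma>)"
    and t: "t \<in> eigenvalues \<Gamma>" and d: "d \<in> eigenvalues \<Gamma>" and "t < d"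
    and rest: "\<And>\<nu>. \<nu> \<in> eigenvalues \<Gamma> \<Longrightarrow> \<nu> \<le> t \<or> \<nu> = d"
  shows "theta 1 \<Gamma> = t"
proof -
  let ?E = "eigenvalues \<Gamma>"
  have d_max: "Max ?E = d"
    using fin d rest \<open>t < d\<close> by (intro Max_eqI) force+
  have t_max: "Max (?E - {d}) = t"
    using fin t rest \<open>t < d\<close> by (intro Max_eqI) force+
  have snoc: "sorted_list_of_set A = sorted_list_of_set (A - {Max A}) @ [Max A]"
    if "finite A" "A \<noteq> {}" for A :: "real set"
  proof (rule sorted_distinct_set_unique)
    show "sorted (sorted_list_of_set (A - {Max A}) @ [Max A])"
      using that by (auto simp: sorted_append)
  qed (use that in \<open>auto intro: Max_in\<close>)
  have "sorted_list_of_set ?E = sorted_list_of_set (?E - {d}) @ [d]"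
    using snoc[OF fin] d d_max by auto
  also have "sorted_list_of_set (?E - {d}) = sorted_list_of_set (?E - {d} - {t}) @ [t]"
    using snoc[of "?E - {d}", unfolded t_max] fin t \<open>t < d\<close> by blast
  finally show ?thesis by (simp add: theta_def)
qed

text \<open>Contains the zero vector and makes sense for every real number, so that spaces can be
  compared as images under linear maps.\<close>

definition eigenspace :: "'v graph \<Rightarrow> real \<Rightarrow> ('v \<Rightarrow> real) set" where
  "eigenspace \<Gamma> \<theta> = {v \<in> extensional (verts \<Gamma>).
     \<forall>x\<in>verts \<Gamma>. (\<Sum>y\<in>verts \<Gamma>. adj_matrix \<Gamma> x y * v y) = \<theta> * v x}"

lemma zero_vec_in_eigenspace: "zero_vec (verts \<Gamma>) \<in> eigenspace \<Gamma> \<theta>"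
  by (simp add: eigenspace_def zero_vec_def)

lemma eigenspace_eq: "eigenspace \<Gamma> \<theta> = {zero_vec (verts \<Gamma>)} \<union> {v. eigenvector \<Gamma> \<theta> v}"
  using zero_vec_in_eigenspace[of \<Gamma> \<theta>] by (auto simp: eigenspace_def eigenvector_def)

lemma eigenvector_iff: "eigenvector \<Gamma> \<theta> v \<longleftrightarrow> v \<in> eigenspace \<Gamma> \<theta> \<and> v \<noteq> zero_vec (verts \<Gamma>)"
  by (auto simp: eigenspace_def eigenvector_def)

text \<open>The invariant carried from graph to graph: \<open>d\<close> is the largest eigenvalue
  and \<open>t\<close> the next one. Finiteness is included because \<open>theta\<close> reads its
  values from \<open>sorted_list_of_set\<close>.\<close>

definition second_eigenspace :: "'v graph \<Rightarrow> real \<Rightarrow> real \<Rightarrow> ('v \<Rightarrow> real) set \<Rightarrow> bool" where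
  "second_eigenspace \<Gamma> d t T \<longleftrightarrow>
     finite (eigenvalues \<Gamma>) \<and> t \<in> eigenvalues \<Gamma> \<and> d \<in> eigenvalues \<Gamma> \<and> t < d \<and>
     (\<forall>\<nu>\<in>eigenvalues \<Gamma>. \<nu> \<le> t \<or> \<nu> = d) \<and> eigenspace \<Gamma> t = T"

lemma second_eigenspaceD:
  assumes "second_eigenspace \<Gamma> d t T"
  shows "T = {zero_vec (verts \<Gamma>)} \<union> {v. eigenvector \<Gamma> (theta 1 \<Gamma>) v}"
  using assms theta_1_eqI[of \<Gamma> t d] by (auto simp: second_eigenspace_def eigenspace_eq)

text \<open>\<open>WT\<close> with an arbitrary family in place of the points, as required for steps
  between consecutive levels.\<close>

definition incidence_transpose :: "'a set set \<Rightarrow> 'a set set \<Rightarrow> ('a set \<Rightarrow> real) \<Rightarrow> 'a set \<Rightarrow> real" where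
  "incidence_transpose P Q f = (\<lambda>B\<in>Q. \<Sum>p\<in>P. incidence p B * f p)"

text \<open>
  If \<open>M\<close> is the incidence matrix and \<open>A\<^sub>1\<close>, \<open>A\<^sub>2\<close> are the adjacency matrices, then the
  hypotheses say \<open>M M\<^sup>T = A\<^sub>1 + a I\<close> and \<open>M\<^sup>T M = A\<^sub>2 + b I\<close>.
\<close>

locale incidence_pair =
  fixes \<Gamma>\<^sub>1 \<Gamma>\<^sub>2 :: "'a set graph" and a b :: real
  assumes finite_verts: "finite (verts \<Gamma>\<^sub>1)" "finite (verts \<Gamma>\<^sub>2)"
    and row_product: "\<And>X Y. X \<in> verts \<Gamma>\<^sub>1 \<Longrightarrow> Y \<in> verts \<Gamma>\<^sub>1 \<Longrightarrow>
      real (card {B \<in> verts \<Gamma>\<^sub>2. X \<subseteq> B \<and> Y \<subseteq> B}) = adj_matrix \<Gamma>\<^sub>1 X Y + (if X = Y then a else 0)"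
    and column_product: "\<And>B C. B \<in> verts \<Gamma>\<^sub>2 \<Longrightarrow> C \<in> verts \<Gamma>\<^sub>2 \<Longrightarrow>
      real (card {X \<in> verts \<Gamma>\<^sub>1. X \<subseteq> B \<and> X \<subseteq> C}) = adj_matrix \<Gamma>\<^sub>2 B C + (if B = C then b else 0)"
begin

abbreviation up :: "('a set \<Rightarrow> real) \<Rightarrow> 'a set \<Rightarrow> real" where
  "up \<equiv> incidence_transpose (verts \<Gamma>\<^sub>1) (verts \<Gamma>\<^sub>2)"

definition down :: "('a set \<Rightarrow> real) \<Rightarrow> 'a set \<Rightarrow> real" where
  "down g = (\<lambda>X\<in>verts \<Gamma>\<^sub>1. \<Sum>B\<in>verts \<Gamma>\<^sub>2. incidence X B * g B)"

text \<open>After exchanging the sums, the coefficient of \<open>f Y\<close> counts the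
  \<open>B\<close> above both \<open>X\<close> and \<open>Y\<close>, which
  \<open>row_product\<close> evaluates.\<close>

lemma down_up:
  assumes "X \<in> verts \<Gamma>\<^sub>1"
  shows "down (up f) X = (\<Sum>Y\<in>verts \<Gamma>\<^sub>1. adj_matrix \<Gamma>\<^sub>1 X Y * f Y) + a * f X"
proof -
  have "down (up f) X = (\<Sum>B\<in>verts \<Gamma>\<^sub>2. \<Sum>Y\<in>verts \<Gamma>\<^sub>1. incidence X B * incidence Y B * f Y)"
    using assms by (simp add: down_def incidence_transpose_def sum_distrib_left mult.assoc)
  also have "\<dots> = (\<Sum>Y\<in>verts \<Gamma>\<^sub>1. (\<Sum>B\<in>verts \<Gamma>\<^sub>2. incidence X B * incidence Y B) * f Y)"
    by (subst sum.swap) (simp add: sum_distrib_right)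
  also have "\<dots> = (\<Sum>Y\<in>verts \<Gamma>\<^sub>1. real (card {B \<in> verts \<Gamma>\<^sub>2. X \<subseteq> B \<and> Y \<subseteq> B}) * f Y)"
  proof (rule sum.cong[OF refl])
    fix Y
    have "(\<Sum>B\<in>verts \<Gamma>\<^sub>2. incidence X B * incidence Y B)
        = (\<Sum>B\<in>verts \<Gamma>\<^sub>2. if X \<subseteq> B \<and> Y \<subseteq> B then 1 else 0)"
      by (intro sum.cong) (auto simp: incidence_def)
    also have "\<dots> = real (card {B \<in> verts \<Gamma>\<^sub>2. X \<subseteq> B \<and> Y \<subseteq> B})"
      using finite_verts by (simp flip: sum.inter_filter)
    finally show "(\<Sum>B\<in>verts \<Gamma>\<^sub>2. incidence X B * incidence Y B) * f Y
        = real (card {B \<in> verts \<Gamma>\<^sub>2. X \<subseteq> B \<and> Y \<subseteq> B}) * f Y" by simp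
  qed
  also have "\<dots> = (\<Sum>Y\<in>verts \<Gamma>\<^sub>1. adj_matrix \<Gamma>\<^sub>1 X Y * f Y + (if X = Y then a * f Y else 0))"
    using assms by (intro sum.cong) (auto simp: row_product algebra_simps)
  finally show ?thesis
    using assms finite_verts by (simp add: sum.distrib)
qed

lemma up_down:
  assumes "B \<in> verts \<Gamma>\<^sub>2"
  shows "up (down g) B = (\<Sum>C\<in>verts \<Gamma>\<^sub>2. adj_matrix \<Gamma>\<^sub>2 B C * g C) + b * g B"
proof -
  have "up (down g) B = (\<Sum>X\<in>verts \<Gamma>\<^sub>1. \<Sum>C\<in>verts \<Gamma>\<^sub>2. incidence X B * incidence X C * g C)"
    using assms by (simp add: down_def incidence_transpose_def sum_distrib_left mult.assoc)
  also have "\<dots> = (\<Sum>C\<in>verts \<Gamma>\<^sub>2. (\<Sum>X\<in>verts \<Gamma>\<^sub>1. incidence X B * incidence X C) * g C)"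
    by (subst sum.swap) (simp add: sum_distrib_right)
  also have "\<dots> = (\<Sum>C\<in>verts \<Gamma>\<^sub>2. real (card {X \<in> verts \<Gamma>\<^sub>1. X \<subseteq> B \<and> X \<subseteq> C}) * g C)"
  proof (rule sum.cong[OF refl])
    fix C
    have "(\<Sum>X\<in>verts \<Gamma>\<^sub>1. incidence X B * incidence X C)
        = (\<Sum>X\<in>verts \<Gamma>\<^sub>1. if X \<subseteq> B \<and> X \<subseteq> C then 1 else 0)"
      by (intro sum.cong) (auto simp: incidence_def)
    also have "\<dots> = real (card {X \<in> verts \<Gamma>\<^sub>1. X \<subseteq> B \<and> X \<subseteq> C})"
      using finite_verts by (simp flip: sum.inter_filter)
    finally show "(\<Sum>X\<in>verts \<Gamma>\<^sub>1. incidence X B * incidence X C) * g C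
        = real (card {X \<in> verts \<Gamma>\<^sub>1. X \<subseteq> B \<and> X \<subseteq> C}) * g C" by simp
  qed
  also have "\<dots> = (\<Sum>C\<in>verts \<Gamma>\<^sub>2. adj_matrix \<Gamma>\<^sub>2 B C * g C + (if B = C then b * g C else 0))"
    using assms by (intro sum.cong) (auto simp: column_product algebra_simps)
  finally show ?thesis
    using assms finite_verts by (simp add: sum.distrib)
qed

lemma down_up_eigenspace:
  "f \<in> eigenspace \<Gamma>\<^sub>1 \<mu> \<Longrightarrow> X \<in> verts \<Gamma>\<^sub>1 \<Longrightarrow> down (up f) X = (\<mu> + a) * f X"
  by (simp add: down_up eigenspace_def algebra_simps)

lemma up_down_eigenspace:
  "g \<in> eigenspace \<Gamma>\<^sub>2 \<mu> \<Longrightarrow> B \<in> verts \<Gamma>\<^sub>2 \<Longrightarrow> up (down g) B = (\<mu> + b) * g B"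
  by (simp add: up_down eigenspace_def algebra_simps)

lemma up_cong: "(\<And>X. X \<in> verts \<Gamma>\<^sub>1 \<Longrightarrow> f X = g X) \<Longrightarrow> up f = up g"
  by (simp add: incidence_transpose_def)

lemma down_cong: "(\<And>B. B \<in> verts \<Gamma>\<^sub>2 \<Longrightarrow> f B = g B) \<Longrightarrow> down f = down g"
  by (simp add: down_def)

text \<open>The case distinction comes from the encoding: off the index set the value of
  \<open>up\<close> is \<open>undefined\<close>, which does not scale.\<close>

lemma up_scale: "up (\<lambda>X. c * f X) B = (if B \<in> verts \<Gamma>\<^sub>2 then c * up f B else undefined)"
  by (simp add: incidence_transpose_def sum_distrib_left algebra_simps)

lemma down_scale: "down (\<lambda>X. c * f X) B = (if B \<in> verts \<Gamma>\<^sub>1 then c * down f B else undefined)"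
  by (simp add: down_def sum_distrib_left algebra_simps)

text \<open>Evaluate M^T M M^T f in two ways: M M^T multiplies f by \<mu> + a, while M^T M is the
  second adjacency matrix plus b I.\<close>

lemma up_eigenspace:
  assumes "f \<in> eigenspace \<Gamma>\<^sub>1 \<mu>"
  shows "up f \<in> eigenspace \<Gamma>\<^sub>2 (\<mu> + a - b)"
proof -
  have "(\<Sum>C\<in>verts \<Gamma>\<^sub>2. adj_matrix \<Gamma>\<^sub>2 B C * up f C) = (\<mu> + a - b) * up f B"
    if "B \<in> verts \<Gamma>\<^sub>2" for B
  proof -
    have "up (down (up f)) = up (\<lambda>X. (\<mu> + a) * f X)"
      using assms by (intro up_cong down_up_eigenspace)
    then show ?thesis
      using that up_down[of B "up f"] up_scale[of "\<mu> + a" f B] by (simp add: left_diff_distrib)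
  qed
  then show ?thesis by (simp add: eigenspace_def incidence_transpose_def)
qed

lemma down_eigenspace:
  assumes "g \<in> eigenspace \<Gamma>\<^sub>2 \<mu>"
  shows "down g \<in> eigenspace \<Gamma>\<^sub>1 (\<mu> + b - a)"
proof -
  have "(\<Sum>Y\<in>verts \<Gamma>\<^sub>1. adj_matrix \<Gamma>\<^sub>1 X Y * down g Y) = (\<mu> + b - a) * down g X"
    if "X \<in> verts \<Gamma>\<^sub>1" for X
  proof -
    have "down (up (down g)) = down (\<lambda>X. (\<mu> + b) * g X)"
      using assms by (intro down_cong up_down_eigenspace)
    then show ?thesis
      using that down_up[of X "down g"] down_scale[of "\<mu> + b" g X] by (simp add: left_diff_distrib)
  qed
  then show ?thesis by (simp add: eigenspace_def down_def)
qed

text \<open>M M^T acts on the eigenspace as the nonzero scalar \<mu> + a, so f can be recovered from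
  M^T f.\<close>

lemma inj_on_up:
  assumes "\<mu> + a \<noteq> 0"
  shows "inj_on up (eigenspace \<Gamma>\<^sub>1 \<mu>)"
proof
  fix f g assume f: "f \<in> eigenspace \<Gamma>\<^sub>1 \<mu>" and g: "g \<in> eigenspace \<Gamma>\<^sub>1 \<mu>" and eq: "up f = up g"
  have "f X = g X" if "X \<in> verts \<Gamma>\<^sub>1" for X
    using down_up_eigenspace[OF f that] down_up_eigenspace[OF g that] eq assms by simp
  then show "f = g" using f g by (auto simp: eigenspace_def intro: extensionalityI)
qed

lemma up_zero: "up (zero_vec (verts \<Gamma>\<^sub>1)) = zero_vec (verts \<Gamma>\<^sub>2)"
  by (auto simp: incidence_transpose_def zero_vec_def)

lemma up_eigenvector:
  assumes "eigenvector \<Gamma>\<^sub>1 \<mu> f" "\<mu> + a \<noteq> 0"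
  shows "eigenvector \<Gamma>\<^sub>2 (\<mu> + a - b) (up f)"
  using assms up_eigenspace[of f \<mu>] inj_onD[OF inj_on_up, of \<mu> f "zero_vec (verts \<Gamma>\<^sub>1)"]
  by (auto simp: eigenvector_iff up_zero zero_vec_in_eigenspace)

text \<open>M^T M acts on the eigenspace of the second graph as the nonzero scalar \<mu> + b, so
  each of its elements is M^T of a multiple of its image under M.\<close>

lemma eigenspace_eq_up_image:
  assumes "\<mu> + b \<noteq> 0"
  shows "eigenspace \<Gamma>\<^sub>2 \<mu> = up ` eigenspace \<Gamma>\<^sub>1 (\<mu> + b - a)"
proof
  show "up ` eigenspace \<Gamma>\<^sub>1 (\<mu> + b - a) \<subseteq> eigenspace \<Gamma>\<^sub>2 \<mu>"
    using up_eigenspace[of _ "\<mu> + b - a"] by auto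
next
  show "eigenspace \<Gamma>\<^sub>2 \<mu> \<subseteq> up ` eigenspace \<Gamma>\<^sub>1 (\<mu> + b - a)"
  proof
    fix g assume g: "g \<in> eigenspace \<Gamma>\<^sub>2 \<mu>"
    \<comment> \<open>Dividing by the scalar before applying \<open>down\<close> makes
      \<open>down ?g\<close> the exact preimage; \<open>restrict\<close> keeps the rescaled vector
      extensional.\<close>
    let ?h = "\<lambda>B. (1 / (\<mu> + b)) * g B"
    let ?g = "restrict ?h (verts \<Gamma>\<^sub>2)"
    have "?g \<in> eigenspace \<Gamma>\<^sub>2 \<mu>"
      using g by (simp add: eigenspace_def flip: sum_divide_distrib)
    moreover have "up (down ?g) = g"
    proof (rule extensionalityI[where A = "verts \<Gamma>\<^sub>2"])
      show "up (down ?g) B = g B" if "B \<in> verts \<Gamma>\<^sub>2" for B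
        using up_down_eigenspace[OF \<open>?g \<in> eigenspace \<Gamma>\<^sub>2 \<mu>\<close> that] that assms by simp
    qed (use g in \<open>auto simp: incidence_transpose_def eigenspace_def\<close>)
    ultimately show "g \<in> up ` eigenspace \<Gamma>\<^sub>1 (\<mu> + b - a)"
      using down_eigenspace by (metis imageI)
  qed
qed

lemma eigenvalue_shift:
  assumes "\<mu> \<in> eigenvalues \<Gamma>\<^sub>2" "\<mu> \<noteq> - b"
  shows "\<mu> + b - a \<in> eigenvalues \<Gamma>\<^sub>1"
proof (rule ccontr)
  assume "\<mu> + b - a \<notin> eigenvalues \<Gamma>\<^sub>1"
  then have "eigenspace \<Gamma>\<^sub>1 (\<mu> + b - a) = {zero_vec (verts \<Gamma>\<^sub>1)}"
    by (auto simp: eigenspace_eq eigenvalues_def)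
  then have "eigenspace \<Gamma>\<^sub>2 \<mu> = {zero_vec (verts \<Gamma>\<^sub>2)}"
    using assms eigenspace_eq_up_image[of \<mu>] up_zero by auto
  then show False using assms(1) by (auto simp: eigenvalues_def eigenvector_iff)
qed

text \<open>Positivity of \<open>t + a\<close> serves three ends: \<open>t\<close> and
  \<open>d\<close> survive the shift because M^T is injective on their eigenspaces, M^T maps onto
  the new eigenspace, and the only possible extra eigenvalue \<open>- b\<close> stays below
  \<open>t + a - b\<close>.\<close>

lemma second_eigenspace_transfer:
  assumes "second_eigenspace \<Gamma>\<^sub>1 d t T" "0 < t + a"
  shows "second_eigenspace \<Gamma>\<^sub>2 (d + a - b) (t + a - b) (up ` T)"
  unfolding second_eigenspace_def
proof (intro conjI ballI)
  have fin: "finite (eigenvalues \<Gamma>\<^sub>1)" and td: "t < d"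
    and rest: "\<And>\<nu>. \<nu> \<in> eigenvalues \<Gamma>\<^sub>1 \<Longrightarrow> \<nu> \<le> t \<or> \<nu> = d"
    and T: "eigenspace \<Gamma>\<^sub>1 t = T"
    using assms(1) by (auto simp: second_eigenspace_def)
  have "eigenvalues \<Gamma>\<^sub>2 \<subseteq> insert (- b) ((\<lambda>\<mu>. \<mu> + a - b) ` eigenvalues \<Gamma>\<^sub>1)"
    using eigenvalue_shift by force
  then show "finite (eigenvalues \<Gamma>\<^sub>2)"
    using fin by (meson finite_imageI finite_insert finite_subset)
  show "t + a - b \<in> eigenvalues \<Gamma>\<^sub>2" "d + a - b \<in> eigenvalues \<Gamma>\<^sub>2"
    using assms td up_eigenvector[of t] up_eigenvector[of d]
    by (fastforce simp: second_eigenspace_def eigenvalues_def)+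
  show "t + a - b < d + a - b" using td by simp
  show "\<nu> \<le> t + a - b \<or> \<nu> = d + a - b" if "\<nu> \<in> eigenvalues \<Gamma>\<^sub>2" for \<nu>
  proof (cases "\<nu> = - b")
    case True
    then show ?thesis using assms(2) by simp
  next
    case False
    then show ?thesis using rest[OF eigenvalue_shift[OF that]] by auto
  qed
  show "eigenspace \<Gamma>\<^sub>2 (t + a - b) = up ` T"
    using eigenspace_eq_up_image[of "t + a - b"] assms(2) T by simp
qed

end

section \<open>Subsets and subspaces in a common setting\<close>

text \<open>The Gaussian bracket \<open>[k]\<^sub>q\<close>, which for \<open>q = 1\<close> is \<open>k\<close>.\<close>

definition bracket :: "nat \<Rightarrow> nat \<Rightarrow> nat" where
  "bracket q k = (\<Sum>i<k. q ^ i)"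

lemma bracket_simps [simp]:
  "bracket q 0 = 0" "bracket q (Suc 0) = 1"
  by (simp_all add: bracket_def)

lemma bracket_Suc: "bracket q (Suc k) = 1 + q * bracket q k"
  by (simp add: bracket_def lessThan_Suc_eq_insert_0 sum.reindex sum_distrib_left)

lemma bracket_pos: "0 < k \<Longrightarrow> 0 < bracket q k"
  by (cases k) (simp_all add: bracket_Suc)

lemma bracket_strict_mono:
  assumes "1 \<le> q" "k < l"
  shows "bracket q k < bracket q l"
  unfolding bracket_def
  using assms by (intro sum_strict_mono2[where b = k]) auto

text \<open>The geometric series scaled by \<open>q ^ j\<close>. For subspaces the right-hand side
  counts the vectors of a rank-l space outside a rank-j subspace, and the second factor counts those
  inside one cover of that subspace.\<close>

lemma bracket_power:
  assumes "1 \<le> q" "j \<le> l"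
  shows "bracket q (l - j) * (q ^ Suc j - q ^ j) = q ^ l - q ^ j"
proof -
  \<comment> \<open>Over \<open>int\<close> subtraction is not truncated, so the sum telescopes by
    induction.\<close>
  have "int (bracket q k) * (int q ^ Suc j - int q ^ j) = int q ^ (j + k) - int q ^ j" for k
    by (induction k) (simp_all add: bracket_def algebra_simps power_add)
  from this[of "l - j"] show ?thesis
    using assms power_increasing[of j "Suc j" q] power_increasing[of j l q]
    by (subst of_nat_eq_iff[where 'a = int, symmetric]) (simp add: of_nat_diff)
qed

lemma card_eq_1_if_ex1: "\<exists>!x. P x \<Longrightarrow> card {x. P x} = 1"
proof -
  assume "\<exists>!x. P x"
  then obtain x where "{x. P x} = {x}" by blast
  then show ?thesis by simp
qed

text \<open>What the counting needs from the lattice of subsets or subspaces, with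
  \<open>G k\<close> as the elements of rank k. \<open>join\<close> supplies a least upper bound in
  place of union or sum; \<open>modular\<close> is the dimension formula for two elements with a
  common upper cover.\<close>

locale geometry =
  fixes G :: "nat \<Rightarrow> 'a set set" and n q :: nat and bottom full :: "'a set"
  assumes q_ge_1: "1 \<le> q"
    and finite_level: "finite (G k)"
    and bottom: "bottom \<in> G 0" "X \<in> G k \<Longrightarrow> bottom \<subseteq> X"
    and full: "full \<in> G n" "X \<in> G k \<Longrightarrow> X \<subseteq> full"
    and antichain: "X \<in> G k \<Longrightarrow> Y \<in> G k \<Longrightarrow> X \<subseteq> Y \<Longrightarrow> X = Y"
    and card_upper_covers: "X \<in> G j \<Longrightarrow> Y \<in> G l \<Longrightarrow> j < l \<Longrightarrow> X \<subseteq> Y \<Longrightarrow>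
      card {Z \<in> G (Suc j). X \<subseteq> Z \<and> Z \<subseteq> Y} = bracket q (l - j)"
    and meet: "C \<in> G k \<Longrightarrow> X \<in> G (Suc k) \<Longrightarrow> Y \<in> G (Suc k) \<Longrightarrow> X \<noteq> Y \<Longrightarrow>
      C \<subseteq> X \<Longrightarrow> C \<subseteq> Y \<Longrightarrow> X \<inter> Y = C"
    and join: "X \<in> G (Suc k) \<Longrightarrow> Y \<in> G (Suc k) \<Longrightarrow> X \<noteq> Y \<Longrightarrow> X \<inter> Y \<in> G k \<Longrightarrow>
      \<exists>Z\<in>G (Suc (Suc k)). X \<subseteq> Z \<and> Y \<subseteq> Z \<and> (\<forall>l. \<forall>W\<in>G l. X \<subseteq> W \<longrightarrow> Y \<subseteq> W \<longrightarrow> Z \<subseteq> W)"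
    and modular: "X \<in> G (Suc k) \<Longrightarrow> Y \<in> G (Suc k) \<Longrightarrow> X \<noteq> Y \<Longrightarrow>
      Z \<in> G (Suc (Suc k)) \<Longrightarrow> X \<subseteq> Z \<Longrightarrow> Y \<subseteq> Z \<Longrightarrow> X \<inter> Y \<in> G k"
begin

abbreviation br :: "nat \<Rightarrow> nat" where "br \<equiv> bracket q"

text \<open>Double count the pairs \<open>Z' \<subseteq> Z\<close> with \<open>Z'\<close> just above \<open>X\<close> and \<open>Z\<close> just below \<open>Y\<close>.\<close>

lemma card_lower_covers:
  assumes "X \<in> G j" "Y \<in> G (Suc l)" "j \<le> l" "X \<subseteq> Y"
  shows "card {Z \<in> G l. X \<subseteq> Z \<and> Z \<subseteq> Y} = br (Suc l - j)"
  using assms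
proof (induction "l - j" arbitrary: X j)
  case 0
  then have "{Z \<in> G l. X \<subseteq> Z \<and> Z \<subseteq> Y} = {X}" "Suc l - j = 1"
    using antichain by auto
  then show ?case by simp
next
  case (Suc i)
  then have jl: "j < l" by simp
  define A where "A = {Z' \<in> G (Suc j). X \<subseteq> Z' \<and> Z' \<subseteq> Y}"
  define B where "B = {Z \<in> G l. X \<subseteq> Z \<and> Z \<subseteq> Y}"
  have fin: "finite A" "finite B"
    by (auto simp: A_def B_def finite_level)
  have "card {Z \<in> B. Z' \<subseteq> Z} = br (l - j)" if "Z' \<in> A" for Z'
  proof -
    have "{Z \<in> B. Z' \<subseteq> Z} = {Z \<in> G l. Z' \<subseteq> Z \<and> Z \<subseteq> Y}"
      using that by (auto simp: A_def B_def)
    then show ?thesis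
      using Suc.hyps(1)[of "Suc j" Z'] Suc.hyps(2) Suc.prems that jl by (auto simp: A_def)
  qed
  moreover have "card {Z' \<in> A. Z' \<subseteq> Z} = br (l - j)" if "Z \<in> B" for Z
  proof -
    have "{Z' \<in> A. Z' \<subseteq> Z} = {Z' \<in> G (Suc j). X \<subseteq> Z' \<and> Z' \<subseteq> Z}"
      using that by (auto simp: A_def B_def)
    then show ?thesis
      using card_upper_covers[OF Suc.prems(1) _ jl] that by (auto simp: B_def)
  qed
  ultimately have "card A * br (l - j) = card B * br (l - j)"
    using sum_multicount_gen[of A B "\<lambda>Z' Z. Z' \<subseteq> Z" "\<lambda>_. br (l - j)"] fin by simp
  then have "card B = card A"
    using jl bracket_pos[of "l - j" q] by (simp add: mult_cancel2)
  moreover have "card A = br (Suc l - j)"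
    unfolding A_def using card_upper_covers[OF Suc.prems(1,2)] Suc.prems by simp
  ultimately show ?case by (simp add: B_def)
qed

lemma card_points_below: "B \<in> G k \<Longrightarrow> 0 < k \<Longrightarrow> card {p \<in> G 1. p \<subseteq> B} = br k"
  using card_upper_covers[OF bottom(1), of B k] bottom(2)
  by (simp add: conj_left_commute cong: conj_cong)

lemma card_points: "0 < n \<Longrightarrow> card (G 1) = br n"
proof -
  assume "0 < n"
  moreover have "{p \<in> G 1. p \<subseteq> full} = G 1" using full(2) by blast
  ultimately show ?thesis using card_points_below[OF full(1)] by simp
qed

section \<open>Points and the complete graph J_q(n,1)\<close>

lemma points_disjoint: "p \<in> G 1 \<Longrightarrow> p' \<in> G 1 \<Longrightarrow> p \<noteq> p' \<Longrightarrow> p \<inter> p' = bottom"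
  using meet[OF bottom(1), of p p'] bottom(2) by simp

lemma WT_eq: "WT G \<B> = incidence_transpose (G 1) \<B>"
  by (simp add: WT_def incidence_transpose_def points_def fun_eq_iff)

lemma U_eq: "U G = {u \<in> extensional (G 1). (\<Sum>x\<in>G 1. u x) = 0}"
  by (simp add: U_def J_def)

lemma J_simps [simp]: "verts (J G k) = G k"
  "adj (J G k) X Y \<longleftrightarrow> X \<noteq> Y \<and> X \<inter> Y \<in> G (k - 1)"
  by (simp_all add: J_def)

lemma adj_points: "p \<in> G 1 \<Longrightarrow> p' \<in> G 1 \<Longrightarrow> adj_matrix (J G 1) p p' = (if p = p' then 0 else 1)"
  using points_disjoint bottom(1) by (auto simp: adj_matrix_def)

text \<open>No point contains another, so W is the identity at level 1; this starts the induction on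
  levels.\<close>

lemma WT_points:
  assumes "u \<in> extensional (G 1)"
  shows "WT G (G 1) u = u"
proof (rule extensionalityI[where A = "G 1"])
  fix B assume "B \<in> G 1"
  moreover have "(\<Sum>p\<in>G 1. incidence p B * u p) = (\<Sum>p\<in>G 1. if p = B then u p else 0)"
    using antichain \<open>B \<in> G 1\<close> by (intro sum.cong) (auto simp: incidence_def)
  ultimately show "WT G (G 1) u B = u B"
    by (simp add: WT_eq incidence_transpose_def finite_level)
qed (use assms in \<open>auto simp: WT_def\<close>)

text \<open>Distinct points meet in \<open>bottom\<close>, so the graph is complete and its
  adjacency matrix is the all-ones matrix minus the identity.\<close>

lemma eigenspace_points:
  assumes "v \<in> extensional (G 1)"
  shows "v \<in> eigenspace (J G 1) t \<longleftrightarrow> (\<forall>p\<in>G 1. (\<Sum>p'\<in>G 1. v p') = (t + 1) * v p)"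
proof -
  have "(\<Sum>p'\<in>G 1. adj_matrix (J G 1) p p' * v p') = (\<Sum>p'\<in>G 1. v p') - v p" if "p \<in> G 1" for p
  proof -
    have "(\<Sum>p'\<in>G 1. adj_matrix (J G 1) p p' * v p') = (\<Sum>p'\<in>G 1. v p' - (if p' = p then v p' else 0))"
      using that by (intro sum.cong) (auto simp: adj_points simp del: One_nat_def)
    then show ?thesis using that by (simp add: sum_subtractf finite_level)
  qed
  then show ?thesis using assms by (auto simp: eigenspace_def algebra_simps)
qed

text \<open>
  The image of this vector under \<open>W\<^sup>T\<close> has the entries \<open>[k]\<close> and \<open>[k] - [n]\<close>, so it is an NZI
  eigenvector for \<open>k < n\<close>.
\<close>

definition spike :: "'a set \<Rightarrow> 'a set \<Rightarrow> real" where
  "spike p\<^sub>0 = (\<lambda>p\<in>G 1. 1 - (if p = p\<^sub>0 then real (br n) else 0))"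

lemma spike_in_U: "p\<^sub>0 \<in> G 1 \<Longrightarrow> 0 < n \<Longrightarrow> spike p\<^sub>0 \<in> U G"
  using card_points by (simp add: U_eq spike_def sum_subtractf finite_level)

lemma second_eigenspace_points:
  assumes "2 \<le> n"
  shows "second_eigenspace (J G 1) (real (br n) - 1) (- 1) (U G)"
  unfolding second_eigenspace_def
proof (intro conjI ballI)
  have card: "card (G 1) = br n" using card_points assms by simp
  have "1 < br n" using bracket_strict_mono[OF q_ge_1, of 1 n] assms by simp
  obtain p\<^sub>0 where p\<^sub>0: "p\<^sub>0 \<in> G 1"
    using card \<open>1 < br n\<close> by (metis all_not_in_conv card.empty not_one_less_zero)
  show U: "eigenspace (J G 1) (- 1) = U G"
    using p\<^sub>0 eigenspace_points[of _ "-1"] by (auto simp: U_eq eigenspace_def)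
  \<comment> \<open>This entry is 1 - [n], and [n] > 1.\<close>
  have "spike p\<^sub>0 p\<^sub>0 \<noteq> 0" using p\<^sub>0 \<open>1 < br n\<close> by (simp add: spike_def)
  then have "eigenvector (J G 1) (- 1) (spike p\<^sub>0)"
    using U spike_in_U[OF p\<^sub>0] assms p\<^sub>0 by (auto simp: eigenvector_iff zero_vec_def)
  then show "- 1 \<in> eigenvalues (J G 1)" by (auto simp: eigenvalues_def)
  have "(\<lambda>p\<in>G 1. 1) \<in> eigenspace (J G 1) (real (br n) - 1)"
    using card by (subst eigenspace_points) auto
  moreover have "(\<lambda>p\<in>G 1. 1 :: real) \<noteq> zero_vec (G 1)"
    using p\<^sub>0 by (auto simp: zero_vec_def fun_eq_iff)
  ultimately show "real (br n) - 1 \<in> eigenvalues (J G 1)"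
    by (auto simp: eigenvalues_def eigenvector_iff)
  show "- 1 < real (br n) - 1" using \<open>1 < br n\<close> by simp
  have ev: "\<nu> = - 1 \<or> \<nu> = real (br n) - 1" if "\<nu> \<in> eigenvalues (J G 1)" for \<nu>
  proof (rule disjCI)
    assume "\<nu> \<noteq> real (br n) - 1"
    obtain v where v: "v \<in> eigenspace (J G 1) \<nu>" "v \<noteq> zero_vec (G 1)"
      using \<open>\<nu> \<in> eigenvalues (J G 1)\<close> by (auto simp: eigenvalues_def eigenvector_iff)
    then have ext: "v \<in> extensional (G 1)" by (simp add: eigenspace_def)
    define s where "s = (\<Sum>p\<in>G 1. v p)"
    have sv: "s = (\<nu> + 1) * v p" if "p \<in> G 1" for p
      using v eigenspace_points[OF ext] that by (simp add: s_def)
    \<comment> \<open>Summing the eigenvalue equation over all points gives [n] s = (\<nu> + 1) s.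
      Hence s = 0 unless \<nu> = [n] - 1, and s = 0 forces \<nu> = -1 at a nonzero entry.\<close>
    have "(\<Sum>p\<in>G 1. s) = (\<Sum>p\<in>G 1. (\<nu> + 1) * v p)"
      by (intro sum.cong refl sv)
    also have "\<dots> = (\<nu> + 1) * s" by (simp only: s_def sum_distrib_left)
    finally have "real (br n) * s = (\<nu> + 1) * s" by (simp only: sum_constant card)
    then have "(\<nu> + 1 - br n) * s = 0" by (simp only: left_diff_distrib diff_self)
    then have "s = 0" using \<open>\<nu> \<noteq> real (br n) - 1\<close> by simp
    have "\<exists>p\<in>G 1. v p \<noteq> 0"
    proof (rule ccontr)
      assume "\<not> ?thesis"
      then have "v = zero_vec (G 1)"
        using ext by (intro extensionalityI[of _ "G 1"]) (auto simp: zero_vec_def)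
      then show False using v by simp
    qed
    then obtain p where "p \<in> G 1" "v p \<noteq> 0" by blast
    from sv[OF \<open>p \<in> G 1\<close>] have "(\<nu> + 1) * v p = 0" unfolding \<open>s = 0\<close> by (rule sym)
    with \<open>v p \<noteq> 0\<close> have "\<nu> + 1 = 0" by (metis mult_eq_0_iff)
    then show "\<nu> = - 1" by (rule eq_neg_iff_add_eq_0[THEN iffD2])
  qed
  have "eigenvalues (J G 1) \<subseteq> {- 1, real (br n) - 1}" using ev by blast
  then show "finite (eigenvalues (J G 1))" by (rule finite_subset) simp
  show "\<nu> \<le> - 1 \<or> \<nu> = real (br n) - 1" if "\<nu> \<in> eigenvalues (J G 1)" for \<nu>
    using ev[OF that] by auto
qed


section \<open>Grassmann and Johnson graphs\<close>

text \<open>Adjacent elements have their join as the only common upper cover, and by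
  \<open>modular\<close> nonadjacent ones have none; below, the intersection plays the role of the
  join and \<open>meet\<close> that of \<open>modular\<close>. Writing levels as
  \<open>Suc i\<close> makes the \<open>k - 1\<close> in \<open>J\<close> a true
  predecessor.\<close>

lemma incidence_pair_J:
  assumes "Suc i < n"
  shows "incidence_pair (J G (Suc i)) (J G (Suc (Suc i))) (br (n - Suc i)) (br (Suc (Suc i)))"
proof
  show "finite (verts (J G (Suc i)))" "finite (verts (J G (Suc (Suc i))))"
    by (simp_all add: finite_level)
next
  fix X Y assume "X \<in> verts (J G (Suc i))" "Y \<in> verts (J G (Suc i))"
  then have X: "X \<in> G (Suc i)" and Y: "Y \<in> G (Suc i)" by simp_all
  let ?A = "{B \<in> G (Suc (Suc i)). X \<subseteq> B \<and> Y \<subseteq> B}"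
  have "real (card ?A) = adj_matrix (J G (Suc i)) X Y + (if X = Y then real (br (n - Suc i)) else 0)"
  proof (cases "X = Y")
    case True
    then have "?A = {B \<in> G (Suc (Suc i)). X \<subseteq> B \<and> B \<subseteq> full}" using full(2) by blast
    then have "card ?A = br (n - Suc i)"
      using card_upper_covers[OF X full(1) assms full(2)[OF X]] by (simp only:)
    then show ?thesis using True by (simp add: adj_matrix_def)
  next
    case neq: False
    show ?thesis
    proof (cases "X \<inter> Y \<in> G i")
      case True
      obtain Z where Z: "Z \<in> G (Suc (Suc i))" "X \<subseteq> Z" "Y \<subseteq> Z"
        and least: "\<forall>l. \<forall>W\<in>G l. X \<subseteq> W \<longrightarrow> Y \<subseteq> W \<longrightarrow> Z \<subseteq> W"
        using join[OF X Y neq True] by (elim bexE conjE)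
      have "B = Z" if "B \<in> ?A" for B
      proof -
        have "B \<in> G (Suc (Suc i))" "Z \<subseteq> B" using least that by auto
        then show ?thesis using antichain[OF Z(1)] by metis
      qed
      then have "?A = {Z}" using Z by blast
      then show ?thesis using neq True by (simp add: adj_matrix_def)
    next
      case False
      then have "?A = {}" using modular[OF X Y neq] by blast
      then show ?thesis using neq False by (simp only: adj_matrix_def) simp
    qed
  qed
  then show "real (card {B \<in> verts (J G (Suc (Suc i))). X \<subseteq> B \<and> Y \<subseteq> B})
      = adj_matrix (J G (Suc i)) X Y + (if X = Y then real (br (n - Suc i)) else 0)" by simp
next
  fix B C assume "B \<in> verts (J G (Suc (Suc i)))" "C \<in> verts (J G (Suc (Suc i)))"
  then have B: "B \<in> G (Suc (Suc i))" and C: "C \<in> G (Suc (Suc i))" by simp_all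
  let ?A = "{X \<in> G (Suc i). X \<subseteq> B \<and> X \<subseteq> C}"
  have "real (card ?A) = adj_matrix (J G (Suc (Suc i))) B C + (if B = C then real (br (Suc (Suc i))) else 0)"
  proof (cases "B = C")
    case True
    then have "?A = {X \<in> G (Suc i). bottom \<subseteq> X \<and> X \<subseteq> B}" using bottom(2) by blast
    then have "card ?A = br (Suc (Suc i))"
      using card_lower_covers[OF bottom(1) B le0 bottom(2)[OF B]] by (simp only: diff_zero)
    then show ?thesis using True by (simp add: adj_matrix_def)
  next
    case neq: False
    show ?thesis
    proof (cases "B \<inter> C \<in> G (Suc i)")
      case True
      then have "?A = {B \<inter> C}" using antichain[of _ "Suc i" "B \<inter> C"] by blast
      then show ?thesis using neq True by (simp add: adj_matrix_def)
    next
      case False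
      then have "?A = {}" using meet[OF _ B C neq] by blast
      then show ?thesis using neq False by (simp only: adj_matrix_def) simp
    qed
  qed
  then show "real (card {X \<in> verts (J G (Suc i)). X \<subseteq> B \<and> X \<subseteq> C})
      = adj_matrix (J G (Suc (Suc i))) B C + (if B = C then real (br (Suc (Suc i))) else 0)" by simp
qed

section \<open>Passing the image of U from level to level\<close>

lemma U_scale: "u \<in> U G \<Longrightarrow> (\<lambda>p\<in>G 1. c * u p) \<in> U G"
  by (simp add: U_eq flip: sum_distrib_left)

lemma WT_scale: "WT G \<B> (\<lambda>p\<in>G 1. c * u p) = (\<lambda>B\<in>\<B>. c * WT G \<B> u B)"
  by (auto simp: WT_eq incidence_transpose_def sum_distrib_left algebra_simps simp del: One_nat_def
      intro!: sum.cong)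

text \<open>A point of \<open>B\<close> lies in exactly [i+1] lower covers of \<open>B\<close>, by
  \<open>card_lower_covers\<close> above that point.\<close>

lemma incidence_transpose_WT:
  "incidence_transpose (G (Suc i)) (G (Suc (Suc i))) (WT G (G (Suc i)) u)
    = (\<lambda>B\<in>G (Suc (Suc i)). br (Suc i) * WT G (G (Suc (Suc i))) u B)"
proof (rule extensionalityI[where A = "G (Suc (Suc i))"])
  fix B assume B: "B \<in> G (Suc (Suc i))"
  have "incidence_transpose (G (Suc i)) (G (Suc (Suc i))) (WT G (G (Suc i)) u) B
      = (\<Sum>C\<in>G (Suc i). \<Sum>p\<in>G 1. incidence C B * incidence p C * u p)"
    using B by (simp add: incidence_transpose_def WT_eq sum_distrib_left mult.assoc)
  also have "\<dots> = (\<Sum>p\<in>G 1. (\<Sum>C\<in>G (Suc i). incidence C B * incidence p C) * u p)"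
    by (subst sum.swap) (simp add: sum_distrib_right)
  also have "\<dots> = (\<Sum>p\<in>G 1. br (Suc i) * (incidence p B * u p))"
  proof (rule sum.cong[OF refl])
    fix p assume p: "p \<in> G 1"
    have "(\<Sum>C\<in>G (Suc i). incidence C B * incidence p C)
        = (\<Sum>C\<in>G (Suc i). if p \<subseteq> C \<and> C \<subseteq> B then 1 else 0)"
      by (intro sum.cong) (auto simp: incidence_def)
    also have "\<dots> = real (card {C \<in> G (Suc i). p \<subseteq> C \<and> C \<subseteq> B})"
      using finite_level by (simp flip: sum.inter_filter)
    also have "\<dots> = br (Suc i) * incidence p B"
    proof (cases "p \<subseteq> B")
      case True
      then show ?thesis using card_lower_covers[OF p B] by (simp add: incidence_def)
    next
      case False
      then have "{C \<in> G (Suc i). p \<subseteq> C \<and> C \<subseteq> B} = {}" by blast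
      then show ?thesis using False by (simp only: incidence_def) simp
    qed
    finally show "(\<Sum>C\<in>G (Suc i). incidence C B * incidence p C) * u p
        = br (Suc i) * (incidence p B * u p)" by simp
  qed
  also have "\<dots> = br (Suc i) * WT G (G (Suc (Suc i))) u B"
    using B by (simp add: WT_eq incidence_transpose_def sum_distrib_left)
  finally show "incidence_transpose (G (Suc i)) (G (Suc (Suc i))) (WT G (G (Suc i)) u) B
      = (\<lambda>B\<in>G (Suc (Suc i)). br (Suc i) * WT G (G (Suc (Suc i))) u B) B"
    using B by simp
qed (auto simp: incidence_transpose_def)

lemma incidence_transpose_WT_image:
  "incidence_transpose (G (Suc i)) (G (Suc (Suc i))) ` WT G (G (Suc i)) ` U G
    = WT G (G (Suc (Suc i))) ` U G" (is "?M ` ?W ` _ = ?W' ` _")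
proof
  have eq: "?M (?W u) = ?W' (\<lambda>p\<in>G 1. real (br (Suc i)) * u p)" for u
    by (simp add: incidence_transpose_WT WT_scale del: One_nat_def)
  then show "?M ` ?W ` U G \<subseteq> ?W' ` U G"
    using U_scale by blast
  show "?W' ` U G \<subseteq> ?M ` ?W ` U G"
  proof
    fix w assume "w \<in> ?W' ` U G"
    then obtain u where u: "u \<in> U G" "w = ?W' u" by blast
    \<comment> \<open>Cancels the positive factor [i+1] picked up when climbing one level.\<close>
    let ?u = "\<lambda>p\<in>G 1. (1 / br (Suc i)) * u p"
    have "(\<lambda>p\<in>G 1. real (br (Suc i)) * ?u p) = u"
      using u bracket_pos[of "Suc i" q]
      by (intro extensionalityI[of _ "G 1"]) (auto simp: U_eq simp del: One_nat_def)
    then have "w = ?M (?W ?u)" using u eq[of ?u] by simp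
    then show "w \<in> ?M ` ?W ` U G" using U_scale[OF u(1)] by blast
  qed
qed

text \<open>
  The closed form \<open>\<theta>\<^sub>1 = q\<^sup>2 [k-1] [n-k-1] - 1\<close> is needed only through \<open>\<theta>\<^sub>1 \<ge> -1\<close>, which keeps
  \<open>\<theta>\<^sub>1 + [n-k]\<close> positive.
\<close>

lemma second_eigenspace_J:
  assumes "Suc i < n"
  shows "\<exists>d. second_eigenspace (J G (Suc i)) d
    (real (q\<^sup>2 * br i * br (n - Suc (Suc i))) - 1) (WT G (G (Suc i)) ` U G)"
  using assms
proof (induction i)
  case 0
  have "WT G (G (Suc 0)) ` U G = U G"
    using WT_points by (force simp: U_eq)
  then show ?case using second_eigenspace_points 0 by auto
next
  case (Suc i)
  \<comment> \<open>Makes every difference below \<open>n\<close> an explicit successor expression,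
    free of truncated subtraction.\<close>
  obtain l where n: "n = Suc (Suc (Suc (i + l)))"
    using Suc.prems by (metis less_iff_Suc_add add_Suc)
  interpret incidence_pair "J G (Suc i)" "J G (Suc (Suc i))" "br (n - Suc i)" "br (Suc (Suc i))"
    using Suc.prems by (intro incidence_pair_J) simp
  let ?t = "real (q\<^sup>2 * br i * br (n - Suc (Suc i))) - 1"
  have "1 < br (n - Suc i)"
    using bracket_strict_mono[OF q_ge_1, of 1 "n - Suc i"] Suc.prems by simp
  then have "1 < real (br (n - Suc i))" by linarith
  moreover have "0 \<le> real (q\<^sup>2 * br i * br (n - Suc (Suc i)))" by (rule of_nat_0_le_iff)
  ultimately have "0 < ?t + br (n - Suc i)" by linarith
  moreover obtain d where "second_eigenspace (J G (Suc i)) d ?t (WT G (G (Suc i)) ` U G)"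
    using Suc by auto
  ultimately have "second_eigenspace (J G (Suc (Suc i))) (d + br (n - Suc i) - br (Suc (Suc i)))
      (?t + br (n - Suc i) - br (Suc (Suc i))) (WT G (G (Suc (Suc i))) ` U G)"
    using second_eigenspace_transfer incidence_transpose_WT_image by (metis J_simps(1))
  \<comment> \<open>As [l+2] - [i+2] = q^2 ([l] - [i]), the claim reduces to [i] [l+1] + [l] - [i] =
    [i+1] [l], which follows from [k+1] = 1 + q [k].\<close>
  moreover have "?t + br (n - Suc i) - br (Suc (Suc i))
      = real (q\<^sup>2 * br (Suc i) * br (n - Suc (Suc (Suc i)))) - 1"
    by (simp add: n bracket_Suc Suc_diff_le algebra_simps power2_eq_square)
  ultimately show ?case by metis
qed

lemma WT_image_J:
  assumes "1 \<le> k" "k < n"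
  shows "WT G (verts (J G k)) ` U G
    = {zero_vec (verts (J G k))} \<union> {v. eigenvector (J G k) (theta 1 (J G k)) v}"
proof -
  obtain i where "k = Suc i" using assms by (cases k) auto
  then show ?thesis
    using second_eigenspace_J[of i] second_eigenspaceD[of "J G k"] assms by (metis J_simps(1))
qed

section \<open>Block graphs of Steiner triple systems\<close>

lemma block_graph_simps [simp]: "verts (block_graph G S) = S"
  "adj (block_graph G S) B C \<longleftrightarrow> B \<noteq> C \<and> (\<exists>p\<in>G 1. p \<subseteq> B \<and> p \<subseteq> C)"
  by (simp_all add: block_graph_def points_def)

lemma STS_subset: "STS G S \<Longrightarrow> S \<subseteq> G 3"
  by (simp add: STS_def)

text \<open>Two points meet in \<open>bottom\<close>, so \<open>join\<close> yields a line that lies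
  in a block exactly when both points do; the defining property for lines then applies.\<close>

lemma STS_ex1_block:
  assumes S: "STS G S" and p: "p \<in> G 1" "p' \<in> G 1" "p \<noteq> p'"
  shows "\<exists>!B. B \<in> S \<and> p \<subseteq> B \<and> p' \<subseteq> B"
proof -
  have "p \<inter> p' \<in> G 0" using points_disjoint[OF p] bottom(1) by simp
  from join[of p 0 p', OF _ _ p(3) this] p(1,2)
  obtain L where L: "L \<in> G 2" "p \<subseteq> L" "p' \<subseteq> L"
    and least: "\<forall>l. \<forall>W\<in>G l. p \<subseteq> W \<longrightarrow> p' \<subseteq> W \<longrightarrow> L \<subseteq> W"
    unfolding One_nat_def numeral_2_eq_2 by (elim bexE conjE meta_impE)
  have "p \<subseteq> B \<and> p' \<subseteq> B \<longleftrightarrow> L \<subseteq> B" if "B \<in> S" for B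
  proof
    have "B \<in> G 3" using STS_subset[OF S] that by blast
    then show "L \<subseteq> B" if "p \<subseteq> B \<and> p' \<subseteq> B" using least that by simp
  qed (use L in blast)
  then show ?thesis using S L(1) unfolding STS_def by metis
qed

text \<open>
  The number \<open>r\<close> of blocks through a point, from counting the pairs of another point and a block
  containing both: \<open>r ([3] - 1) = [n] - 1\<close>.
\<close>

definition replication :: real where
  "replication = (real (br n) - 1) / (real (br 3) - 1)"

lemma card_blocks_through_point:
  assumes S: "STS G S" and "3 < n" and p: "p \<in> G 1"
  shows "real (card {B \<in> S. p \<subseteq> B}) = replication"
proof -
  have fin: "finite (G 1)" "finite S"
    using finite_level STS_subset[OF S] by (auto intro: finite_subset)
  let ?P = "G 1 - {p}" and ?S = "{B \<in> S. p \<subseteq> B}"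
  have "card {p' \<in> ?P. p' \<subseteq> B} = br 3 - 1" if "B \<in> ?S" for B
  proof -
    have "{p' \<in> ?P. p' \<subseteq> B} = {p' \<in> G 1. p' \<subseteq> B} - {p}" by blast
    moreover have "B \<in> G 3" "p \<subseteq> B" using that STS_subset[OF S] by auto
    then have "p \<in> {p' \<in> G 1. p' \<subseteq> B}" "card {p' \<in> G 1. p' \<subseteq> B} = br 3"
      using p card_points_below by simp_all
    ultimately show ?thesis by (simp only: card_Diff_singleton)
  qed
  moreover have "card {B \<in> ?S. p' \<subseteq> B} = 1" if "p' \<in> ?P" for p'
  proof -
    have "{B \<in> ?S. p' \<subseteq> B} = {B. B \<in> S \<and> p \<subseteq> B \<and> p' \<subseteq> B}" by blast
    moreover have "p' \<in> G 1" "p \<noteq> p'" using that by auto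
    ultimately show ?thesis using card_eq_1_if_ex1[OF STS_ex1_block[OF S p]] by simp
  qed
  ultimately have "card ?P = (br 3 - 1) * card ?S"
    using sum_multicount[of ?P ?S "\<lambda>p' B. p' \<subseteq> B" "br 3 - 1"] fin by simp
  moreover have "card ?P = br n - 1" using p fin card_points \<open>3 < n\<close> by simp
  moreover have "1 < br 3" "1 < br n"
    using bracket_strict_mono[OF q_ge_1, of 1] \<open>3 < n\<close> by simp_all
  ultimately have "real (br n - 1) = real (br 3 - 1) * real (card ?S)"
    by (metis of_nat_mult)
  then have "real (br n) - 1 = (real (br 3) - 1) * real (card ?S)"
    using \<open>1 < br 3\<close> \<open>1 < br n\<close> by (simp add: of_nat_diff)
  then show ?thesis using \<open>1 < br 3\<close> by (simp add: replication_def)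
qed

text \<open>Gives \<open>0 < t + a\<close> for the transfer with t = -1 and a =
  \<open>replication\<close>. For n = 3 the value would be 1.\<close>

lemma replication_gt_1:
  assumes "3 < n"
  shows "1 < replication"
  using bracket_strict_mono[OF q_ge_1, of 1 3] bracket_strict_mono[OF q_ge_1 assms]
  by (simp add: replication_def)

text \<open>Two points lie in exactly one common block, matching the complete graph on points.
  Consequently two distinct blocks share at most one point, so their common points number 1 or 0
  according to adjacency.\<close>

lemma incidence_pair_block_graph:
  assumes S: "STS G S" and "3 < n"
  shows "incidence_pair (J G 1) (block_graph G S) replication (br 3)"
proof
  show "finite (verts (J G 1))" "finite (verts (block_graph G S))"
    using finite_level STS_subset[OF S] by (auto intro: finite_subset)
next
  fix p p' assume "p \<in> verts (J G 1)" "p' \<in> verts (J G 1)"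
  then have p: "p \<in> G 1" "p' \<in> G 1" by simp_all
  have "card {B \<in> S. p \<subseteq> B \<and> p' \<subseteq> B} = 1" if "p \<noteq> p'"
    using card_eq_1_if_ex1[OF STS_ex1_block[OF S p that]] .
  then show "real (card {B \<in> verts (block_graph G S). p \<subseteq> B \<and> p' \<subseteq> B})
      = adj_matrix (J G 1) p p' + (if p = p' then replication else 0)"
    using card_blocks_through_point[OF assms p(1)] adj_points[OF p]
    by (cases "p = p'") (simp_all del: One_nat_def)
next
  fix B C assume "B \<in> verts (block_graph G S)" "C \<in> verts (block_graph G S)"
  then have B: "B \<in> S" and C: "C \<in> S" by simp_all
  have "real (card {X \<in> G 1. X \<subseteq> B \<and> X \<subseteq> C})
      = adj_matrix (block_graph G S) B C + (if B = C then real (br 3) else 0)"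
  proof (cases "B = C")
    case True
    then show ?thesis
      using card_points_below[of B 3] B STS_subset[OF S] by (auto simp: adj_matrix_def)
  next
    case neq: False
    show ?thesis
    proof (cases "\<exists>p\<in>G 1. p \<subseteq> B \<and> p \<subseteq> C")
      case True
      then obtain p where p: "p \<in> G 1" "p \<subseteq> B" "p \<subseteq> C" by blast
      have "p' = p" if "p' \<in> G 1" "p' \<subseteq> B" "p' \<subseteq> C" for p'
        using STS_ex1_block[OF S p(1) that(1)] B C neq p that by blast
      then have "{X \<in> G 1. X \<subseteq> B \<and> X \<subseteq> C} = {p}" using p by blast
      then show ?thesis using neq True by (simp add: adj_matrix_def)
    next
      case False
      then have "{X \<in> G 1. X \<subseteq> B \<and> X \<subseteq> C} = {}" by blast
      then show ?thesis using neq False by (simp only: adj_matrix_def) simp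
    qed
  qed
  then show "real (card {X \<in> verts (J G 1). X \<subseteq> B \<and> X \<subseteq> C})
      = adj_matrix (block_graph G S) B C + (if B = C then real (br 3) else 0)" by simp
qed

lemma U_eq_eigenspace:
  assumes "2 \<le> n"
  shows "U G = {zero_vec (verts (J G 1))} \<union> {v. eigenvector (J G 1) (theta 1 (J G 1)) v}"
  using second_eigenspaceD[OF second_eigenspace_points[OF assms]] .

context
  fixes S
  assumes S: "STS G S" and n: "3 < n"
  notes One_nat_def [simp del]
begin

interpretation blocks: incidence_pair "J G 1" "block_graph G S" replication "br 3"
  using S n by (rule incidence_pair_block_graph)

text \<open>A single transfer, directly from the complete graph on the points with t = -1.\<close>

lemma WT_image_block_graph: "WT G S ` U G
    = {zero_vec S} \<union> {v. eigenvector (block_graph G S) (theta 1 (block_graph G S)) v}"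
  using blocks.second_eigenspace_transfer[OF second_eigenspace_points] n replication_gt_1
  by (auto simp: WT_eq dest!: second_eigenspaceD)

section \<open>Restriction to the blocks and extension from them\<close>

lemma inj_on_WT_blocks: "inj_on (WT G S) (U G)"
  using blocks.inj_on_up[of "- 1"] second_eigenspace_points n replication_gt_1
  by (simp add: WT_eq second_eigenspace_def)

text \<open>\<open>S \<subseteq> G 3\<close>, so W_S consists of columns of W. Restriction and
  extension of eigenvectors both rest on this.\<close>

lemma restrict_WT: "restrict (WT G (G 3) u) S = WT G S u"
  using STS_subset[OF S] by (auto simp: WT_def restrict_def fun_eq_iff)

lemma zero_in_U: "zero_vec (G 1) \<in> U G"
  by (simp add: U_eq zero_vec_def)

lemma WT_zero: "WT G \<B> (zero_vec (G 1)) = zero_vec \<B>"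
  by (auto simp: WT_eq incidence_transpose_def zero_vec_def simp del: One_nat_def)

lemma WT_blocks_eq_zero_iff: "u \<in> U G \<Longrightarrow> WT G S u = zero_vec S \<longleftrightarrow> u = zero_vec (G 1)"
  using inj_on_eq_iff[OF inj_on_WT_blocks _ zero_in_U] WT_zero[of S] by simp

text \<open>The kernel is trivial already after restriction to the blocks.\<close>

lemma WT_G3_eq_zero_iff:
  assumes "u \<in> U G"
  shows "WT G (G 3) u = zero_vec (G 3) \<longleftrightarrow> u = zero_vec (G 1)"
proof
  assume "WT G (G 3) u = zero_vec (G 3)"
  then have "WT G S u = restrict (zero_vec (G 3)) S"
    by (simp flip: restrict_WT)
  also have "\<dots> = zero_vec S"
    by (metis WT_zero restrict_WT)
  finally show "u = zero_vec (G 1)" using WT_blocks_eq_zero_iff[OF assms] by simp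
qed (simp add: WT_zero)

text \<open>Nonzero elements of U parametrise the eigenvectors here and in J_q(n,3), so the two can
  be compared through u.\<close>

lemma eigenvector_block_graph_iff:
  "eigenvector (block_graph G S) (theta 1 (block_graph G S)) w
    \<longleftrightarrow> (\<exists>u\<in>U G. u \<noteq> zero_vec (G 1) \<and> w = WT G S u)"
proof -
  have "eigenvector (block_graph G S) (theta 1 (block_graph G S)) w
      \<longleftrightarrow> w \<in> WT G S ` U G \<and> w \<noteq> zero_vec S"
    unfolding WT_image_block_graph by (auto simp: eigenvector_def)
  also have "\<dots> \<longleftrightarrow> (\<exists>u\<in>U G. u \<noteq> zero_vec (G 1) \<and> w = WT G S u)"
    by (auto simp: WT_blocks_eq_zero_iff)
  finally show ?thesis .
qed

lemma eigenvector_J3_iff: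
  "eigenvector (J G 3) (theta 1 (J G 3)) v
    \<longleftrightarrow> (\<exists>u\<in>U G. u \<noteq> zero_vec (G 1) \<and> v = WT G (G 3) u)"
proof -
  have "eigenvector (J G 3) (theta 1 (J G 3)) v \<longleftrightarrow> v \<in> WT G (G 3) ` U G \<and> v \<noteq> zero_vec (G 3)"
    using WT_image_J[of 3] n by (auto simp: eigenvector_def)
  also have "\<dots> \<longleftrightarrow> (\<exists>u\<in>U G. u \<noteq> zero_vec (G 1) \<and> v = WT G (G 3) u)"
    by (auto simp: WT_G3_eq_zero_iff)
  finally show ?thesis .
qed

lemma eigenvector_restrict:
  assumes "eigenvector (J G 3) (theta 1 (J G 3)) v"
  shows "eigenvector (block_graph G S) (theta 1 (block_graph G S)) (restrict v S)"
  using assms restrict_WT by (auto simp: eigenvector_J3_iff eigenvector_block_graph_iff)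

lemma eigenvector_extends:
  assumes "eigenvector (block_graph G S) (theta 1 (block_graph G S)) w"
  shows "\<exists>!v. eigenvector (J G 3) (theta 1 (J G 3)) v \<and> restrict v S = w"
proof -
  obtain u where u: "u \<in> U G" "u \<noteq> zero_vec (G 1)" "w = WT G S u"
    using assms by (auto simp: eigenvector_block_graph_iff)
  show ?thesis
  proof (rule ex1I[of _ "WT G (G 3) u"])
    show "eigenvector (J G 3) (theta 1 (J G 3)) (WT G (G 3) u) \<and> restrict (WT G (G 3) u) S = w"
      using u restrict_WT by (auto simp: eigenvector_J3_iff)
    show "v = WT G (G 3) u"
      if v: "eigenvector (J G 3) (theta 1 (J G 3)) v \<and> restrict v S = w" for v
    proof -
      obtain u' where u': "u' \<in> U G" "v = WT G (G 3) u'"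
        using v by (auto simp: eigenvector_J3_iff)
      \<comment> \<open>A second extension comes from some u' with the same image under W_S, which
        is injective on U.\<close>
      then have "WT G S u' = WT G S u" using v u(3) restrict_WT by simp
      then have "u' = u" using inj_onD[OF inj_on_WT_blocks] u'(1) u(1) by blast
      then show ?thesis using u'(2) by simp
    qed
  qed
qed

section \<open>NZI eigenvectors and the inequality for m\<close>

lemma ex_point: "\<exists>p. p \<in> G 1"
proof -
  have "0 < card (G 1)" using card_points bracket_pos[of n q] n by simp
  then show ?thesis using finite_level by (auto simp: card_gt_0_iff)
qed

text \<open>Ensures that the \<open>LEAST\<close> in \<open>m 1 (J G 3)\<close> is attained.\<close>

lemma ex_NZI_eigenvector: "\<exists>v. eigenvector (J G 3) (theta 1 (J G 3)) v \<and> NZI (G 3) v"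
proof -
  obtain p\<^sub>0 where p\<^sub>0: "p\<^sub>0 \<in> G 1" using ex_point by blast
  have br: "1 < br n" "br 3 < br n" "0 < br 3"
    using bracket_strict_mono[OF q_ge_1, of 1 n] bracket_strict_mono[OF q_ge_1, of 3 n] n
      bracket_pos[of 3 q] by simp_all
  have "WT G (G 3) (spike p\<^sub>0) B = real (br 3) - (if p\<^sub>0 \<subseteq> B then real (br n) else 0)"
    if B: "B \<in> G 3" for B
  proof -
    have "WT G (G 3) (spike p\<^sub>0) B = (\<Sum>p\<in>G 1. (if p \<subseteq> B then 1 else 0)
        - (if p = p\<^sub>0 then if p\<^sub>0 \<subseteq> B then real (br n) else 0 else 0))"
      using B by (auto simp: WT_eq incidence_transpose_def incidence_def spike_def
          simp del: One_nat_def intro!: sum.cong)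
    also have "\<dots> = real (card {p \<in> G 1. p \<subseteq> B}) - (if p\<^sub>0 \<subseteq> B then real (br n) else 0)"
      using p\<^sub>0 finite_level by (simp add: sum_subtractf flip: sum.inter_filter)
    finally show ?thesis using card_points_below[OF B] by simp
  qed
  then have "NZI (G 3) (WT G (G 3) (spike p\<^sub>0))"
    using br by (auto simp: NZI_def)
  moreover have "spike p\<^sub>0 p\<^sub>0 \<noteq> 0" using p\<^sub>0 br by (simp add: spike_def)
  then have "spike p\<^sub>0 \<noteq> zero_vec (G 1)" using p\<^sub>0 by (auto simp: zero_vec_def)
  ultimately show ?thesis
    using spike_in_U[OF p\<^sub>0] n by (auto simp: eigenvector_J3_iff)
qed

text \<open>Makes the \<open>Max\<close> in \<open>sup_norm\<close> over \<open>S\<close>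
  meaningful.\<close>

lemma S_nonempty: "S \<noteq> {}"
proof -
  obtain p where "p \<in> G 1" using ex_point by blast
  then have "{B \<in> S. p \<subseteq> B} \<noteq> {}"
    using card_blocks_through_point[OF S n] replication_gt_1[OF n]
    by (metis card.empty not_one_less_zero of_nat_0 of_nat_1 of_nat_less_iff)
  then show ?thesis by blast
qed

text \<open>Restrict a minimiser from J_q(n,3): it remains an NZI eigenvector, and its maximum is
  taken over fewer entries.\<close>

lemma m_block_graph_le: "m 1 (block_graph G S) \<le> m 1 (J G 3)"
proof -
  let ?P = "\<lambda>\<Gamma> c. \<exists>u. eigenvector \<Gamma> (theta 1 \<Gamma>) u \<and> NZI (verts \<Gamma>) u
    \<and> real c = sup_norm (verts \<Gamma>) u + 1"
  have norm: "\<exists>c. real c = sup_norm V v + 1" if "finite V" "V \<noteq> {}" "NZI V v"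
    for V and v :: "'a set \<Rightarrow> real"
  proof -
    have "sup_norm V v \<in> (\<lambda>x. \<bar>v x\<bar>) ` V"
      unfolding sup_norm_def using that by (intro Max_in) auto
    then have "sup_norm V v \<in> \<int>" "0 \<le> sup_norm V v"
      using that by (auto simp: NZI_def)
    then have "sup_norm V v \<in> \<nat>" by (simp add: Nats_altdef2)
    then show ?thesis by (metis Nats_cases of_nat_Suc add.commute)
  qed
  have fin: "finite (G 3)" "finite S" "S \<subseteq> G 3"
    using finite_level STS_subset[OF S] by (auto intro: finite_subset)
  have "\<exists>c. ?P (J G 3) c"
    using ex_NZI_eigenvector norm[OF fin(1)] S_nonempty fin(3) by (metis J_simps(1) subset_empty)
  then have "?P (J G 3) (m 1 (J G 3))"
    unfolding m_def by (rule LeastI_ex)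
  then obtain u where u: "eigenvector (J G 3) (theta 1 (J G 3)) u" "NZI (G 3) u"
    "real (m 1 (J G 3)) = sup_norm (G 3) u + 1" by auto
  have nzi: "NZI S (restrict u S)" using u(2) fin(3) by (auto simp: NZI_def)
  obtain c where c: "real c = sup_norm S (restrict u S) + 1"
    using norm[OF fin(2) S_nonempty nzi] by blast
  have "m 1 (block_graph G S) \<le> c"
    unfolding m_def using eigenvector_restrict[OF u(1)] nzi c by (intro Least_le) auto
  also have "sup_norm S (restrict u S) \<le> sup_norm (G 3) u"
    unfolding sup_norm_def using fin S_nonempty by (intro Max_mono) auto
  then have "c \<le> m 1 (J G 3)" using c u(3) by linarith
  finally show ?thesis .
qed

end

end

section \<open>The two geometries\<close>

lemma geometry_subsets: "geometry (subsets n) n 1 {} {1..n}"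
proof
  have bracket_1: "bracket 1 k = k" for k by (simp add: bracket_def)
  show fin: "finite (subsets n k)" for k by (simp add: subsets_def)
  have level: "finite X" "card X = k" if "X \<in> subsets n k" for X k
    using that by (auto simp: subsets_def intro: finite_subset)
  show "X = Y" if "X \<in> subsets n k" "Y \<in> subsets n k" "X \<subseteq> Y" for X Y k
    using that level card_subset_eq by metis
  show "card {Z \<in> subsets n (Suc j). X \<subseteq> Z \<and> Z \<subseteq> Y} = bracket 1 (l - j)"
    if X: "X \<in> subsets n j" and Y: "Y \<in> subsets n l" and "j < l" "X \<subseteq> Y" for X Y j l
  proof -
    \<comment> \<open>A cover of \<open>X\<close> inside \<open>Y\<close> adds one element of
      \<open>Y - X\<close>, so there are l - j of them.\<close>
    have "{Z \<in> subsets n (Suc j). X \<subseteq> Z \<and> Z \<subseteq> Y} = (\<lambda>y. insert y X) ` (Y - X)"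
    proof safe
      fix Z assume Z: "Z \<in> subsets n (Suc j)" "X \<subseteq> Z" "Z \<subseteq> Y"
      then have "card (Z - X) = 1"
        using level[OF X] level[OF Z(1)] by (simp add: card_Diff_subset)
      then obtain y where "Z - X = {y}" by (auto simp: card_1_singleton_iff)
      then show "Z \<in> (\<lambda>y. insert y X) ` (Y - X)" using Z by auto
    next
      fix y assume "y \<in> Y" "y \<notin> X"
      then show "insert y X \<in> subsets n (Suc j)"
        using X Y level[OF X] by (auto simp: subsets_def)
    qed (use \<open>X \<subseteq> Y\<close> in auto)
    moreover have "inj_on (\<lambda>y. insert y X) (Y - X)" by (auto simp: inj_on_def)
    ultimately show ?thesis
      using level[OF X] level[OF Y] \<open>X \<subseteq> Y\<close> 
      by (simp add: card_image card_Diff_subset bracket_1 del: One_nat_def)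
  qed
  show "X \<inter> Y = C" if C: "C \<in> subsets n k" and X: "X \<in> subsets n (Suc k)"
    and Y: "Y \<in> subsets n (Suc k)" and "X \<noteq> Y" "C \<subseteq> X" "C \<subseteq> Y" for C X Y k
  proof -
    have "X \<inter> Y \<noteq> X"
      using \<open>X \<noteq> Y\<close> level[OF X] level[OF Y] card_subset_eq[of Y X] by auto
    then have "card (X \<inter> Y) < Suc k"
      using level[OF X] psubset_card_mono[of X "X \<inter> Y"] by auto
    then show ?thesis
      using level[OF C] level[OF X] that(5,6) card_seteq[of "X \<inter> Y" C] by auto
  qed
  show "\<exists>Z\<in>subsets n (Suc (Suc k)).
      X \<subseteq> Z \<and> Y \<subseteq> Z \<and> (\<forall>l. \<forall>W\<in>subsets n l. X \<subseteq> W \<longrightarrow> Y \<subseteq> W \<longrightarrow> Z \<subseteq> W)"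
    if X: "X \<in> subsets n (Suc k)" and Y: "Y \<in> subsets n (Suc k)"
      and XY: "X \<inter> Y \<in> subsets n k" for X Y k
  proof (rule bexI[of _ "X \<union> Y"])
    show "X \<union> Y \<in> subsets n (Suc (Suc k))"
      using X Y level[OF XY] level[OF X] level[OF Y] card_Un_Int[of X Y] by (auto simp: subsets_def)
  qed auto
  show "X \<inter> Y \<in> subsets n k" if X: "X \<in> subsets n (Suc k)" and Y: "Y \<in> subsets n (Suc k)"
    and "X \<noteq> Y" and Z: "Z \<in> subsets n (Suc (Suc k))" and "X \<subseteq> Z" "Y \<subseteq> Z" for X Y Z k
  proof -
    \<comment> \<open>Squeezes the size of the union to k + 2; inclusion-exclusion then gives k for
      the intersection.\<close>
    have "X \<union> Y \<noteq> X"
      using \<open>X \<noteq> Y\<close> level[OF X] level[OF Y] card_subset_eq[of X Y] by auto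
    then have "Suc k < card (X \<union> Y)"
      using level[OF X] level[OF Y] psubset_card_mono[of "X \<union> Y" X] by auto
    moreover have "card (X \<union> Y) \<le> Suc (Suc k)"
      using level[OF Z] that(5,6) card_mono[of Z "X \<union> Y"] by simp
    ultimately have "card (X \<inter> Y) = k"
      using level[OF X] level[OF Y] card_Un_Int[of X Y] by simp
    then show ?thesis using X by (auto simp: subsets_def)
  qed
qed (auto simp: subsets_def)

section \<open>Counting vectors in subspaces over a finite field\<close>

lemma card_span_independent:
  fixes B :: "('f::{field,finite} ^ 'n::finite) set"
  assumes "vec.independent B"
  shows "card (vec.span B) = CARD('f) ^ card B"
  using finite[of B] assms
proof (induction B rule: finite_induct)
  case empty
  then show ?case by simp
next
  case (insert x B)
  let ?f = "\<lambda>(c, v). c *s x + v"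
  have x: "x \<notin> vec.span B" and ind: "vec.independent B"
    using insert by (simp_all add: vec.independent_insert)
  have "vec.span (insert x B) = ?f ` (UNIV \<times> vec.span B)"
  proof (intro set_eqI iffI)
    fix y assume "y \<in> vec.span (insert x B)"
    then obtain c where "y - c *s x \<in> vec.span B" by (auto simp: vec.span_breakdown_eq)
    then have "(c, y - c *s x) \<in> UNIV \<times> vec.span B" "y = ?f (c, y - c *s x)" by simp_all
    then show "y \<in> ?f ` (UNIV \<times> vec.span B)" by blast
  next
    fix y assume "y \<in> ?f ` (UNIV \<times> vec.span B)"
    then obtain c v where "v \<in> vec.span B" "y = c *s x + v" by auto
    then show "y \<in> vec.span (insert x B)"
      by (auto simp: vec.span_breakdown_eq intro!: exI[of _ c])
  qed
  moreover have "inj_on ?f (UNIV \<times> vec.span B)"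
  proof (rule inj_onI; clarify)
    fix c v c' v' assume v: "v \<in> vec.span B" "v' \<in> vec.span B" and eq: "c *s x + v = c' *s x + v'"
    have "(c - c') *s x = v' - v"
      using eq by (simp add: vec.scale_left_diff_distrib algebra_simps)
    \<comment> \<open>If the scalars differed, dividing by their difference would put
      \<open>x\<close> into the span of \<open>B\<close>.\<close>
    then have "(c - c') *s x \<in> vec.span B" using v by (simp add: vec.span_diff)
    then have "inverse (c - c') *s ((c - c') *s x) \<in> vec.span B"
      by (rule vec.span_scale)
    then have "(inverse (c - c') * (c - c')) *s x \<in> vec.span B"
      by (simp only: vec.scale_scale)
    then have "c = c'"
      using x by (cases "c = c'") simp_all
    then show "c = c' \<and> v = v'" using eq by simp
  qed
  ultimately show ?case
    using insert ind by (simp add: card_image)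
qed

lemma card_subspace:
  fixes X :: "('f::{field,finite} ^ 'n::finite) set"
  assumes "vec.subspace X"
  shows "card X = CARD('f) ^ vec.dim X"
proof -
  obtain B where "B \<subseteq> X" "vec.independent B" "X \<subseteq> vec.span B" "card B = vec.dim X"
    using vec.basis_exists by metis
  then show ?thesis
    using card_span_independent[of B] vec.span_subspace[of B X] assms by simp
qed

lemma geometry_subspaces:
  "geometry (subspaces :: nat \<Rightarrow> ('f::{field,finite} ^ 'n::finite) set set)
    CARD('n) CARD('f) {0} UNIV"
proof
  let ?q = "CARD('f)"
  let ?G = "subspaces :: nat \<Rightarrow> ('f ^ 'n) set set"
  have q2: "2 \<le> ?q"
    using card_mono[of UNIV "{0, 1 :: 'f}"] by simp
  then show "1 \<le> ?q" by simp
  show "finite (?G k)" for k by simp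
  show "{0} \<in> ?G 0" by (simp add: subspaces_def vec.subspace_single_0)
  show "{0} \<subseteq> X" if "X \<in> ?G k" for X k
    using that by (simp add: subspaces_def vec.subspace_0)
  show "UNIV \<in> ?G CARD('n)" 
    using vec_dim_card by (simp add: subspaces_def del: vec.dim_UNIV)
  show antichain: "X = Y" if "X \<in> ?G k" "Y \<in> ?G k" "X \<subseteq> Y" for X Y k
    using that vec.subspace_dim_equal[of X Y] by (simp add: subspaces_def)
  have sub: "vec.subspace X" and dim: "vec.dim X = k" if "X \<in> ?G k" for X k
    using that by (simp_all add: subspaces_def)
  have extend: "vec.span (insert v X) \<in> ?G (Suc k)" if X: "X \<in> ?G k" and "v \<notin> X" for X k v
    using that sub[OF X] dim[OF X]
    by (simp add: subspaces_def vec.dim_insert vec.span_eq_iff[THEN iffD2])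
  show "card {Z \<in> ?G (Suc j). X \<subseteq> Z \<and> Z \<subseteq> Y} = bracket ?q (l - j)"
    if X: "X \<in> ?G j" and Y: "Y \<in> ?G l" and jl: "j < l" and XY: "X \<subseteq> Y" for X Y j l
  proof -
    let ?A = "{Z \<in> ?G (Suc j). X \<subseteq> Z \<and> Z \<subseteq> Y}"
    \<comment> \<open>Any vector of \<open>Z - X\<close> determines the cover \<open>Z\<close> by
      dimension, so the sets \<open>Z - X\<close> partition \<open>Y - X\<close> into classes of
      equal size.\<close>
    have unique: "Z = vec.span (insert v X)" if "Z \<in> ?A" "v \<in> Z - X" for Z v
    proof -
      have "vec.span (insert v X) \<subseteq> Z"
        using that sub by (intro vec.span_minimal) auto
      then show ?thesis using antichain[OF extend[OF X, of v], of Z] that by auto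
    qed
    have disj: "(Z - X) \<inter> (Z' - X) = {}" if "Z \<in> ?A" "Z' \<in> ?A" "Z \<noteq> Z'" for Z Z'
      using unique[OF that(1)] unique[OF that(2)] that(3) by (metis IntD1 IntD2 ex_in_conv)
    have "Y - X = (\<Union>Z\<in>?A. Z - X)"
    proof
      show "Y - X \<subseteq> (\<Union>Z\<in>?A. Z - X)"
      proof
        fix v assume v: "v \<in> Y - X"
        have "vec.span (insert v X) \<subseteq> Y"
          using v XY sub[OF Y] by (intro vec.span_minimal) auto
        moreover have "insert v X \<subseteq> vec.span (insert v X)" by (rule vec.span_superset)
        ultimately show "v \<in> (\<Union>Z\<in>?A. Z - X)"
          using v extend[OF X, of v] by blast
      qed
    qed auto
    also have "card \<dots> = (\<Sum>Z\<in>?A. card (Z - X))"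
      using disj by (intro card_UN_disjoint) auto
    also have "\<dots> = (\<Sum>Z\<in>?A. ?q ^ Suc j - ?q ^ j)"
    proof (rule sum.cong[OF refl])
      fix Z assume "Z \<in> ?A"
      then show "card (Z - X) = ?q ^ Suc j - ?q ^ j"
        using card_subspace[OF sub, of Z "Suc j"] card_subspace[OF sub[OF X]] dim[OF X] dim[of Z "Suc j"]
        by (simp add: card_Diff_subset)
    qed
    finally have "card ?A * (?q ^ Suc j - ?q ^ j) = card (Y - X)" by simp
    also have "\<dots> = ?q ^ l - ?q ^ j"
      using card_subspace[OF sub[OF X]] card_subspace[OF sub[OF Y]] dim[OF X] dim[OF Y] XY
      by (simp add: card_Diff_subset)
    also have "\<dots> = bracket ?q (l - j) * (?q ^ Suc j - ?q ^ j)"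
      using jl q2 by (intro bracket_power[symmetric]) simp_all
    finally have "card ?A * (?q ^ Suc j - ?q ^ j) = bracket ?q (l - j) * (?q ^ Suc j - ?q ^ j)" .
    moreover have "?q ^ j < ?q ^ Suc j"
      using q2 by (intro power_strict_increasing) auto
    then have "?q ^ Suc j - ?q ^ j \<noteq> 0" by linarith
    ultimately show ?thesis using mult_right_cancel by blast
  qed
  show "X \<inter> Y = C" if C: "C \<in> ?G k" and X: "X \<in> ?G (Suc k)" and Y: "Y \<in> ?G (Suc k)"
    and neq: "X \<noteq> Y" and CX: "C \<subseteq> X" and CY: "C \<subseteq> Y" for C X Y k
  proof (rule ccontr)
    assume "X \<inter> Y \<noteq> C"
    then obtain v where v: "v \<in> X" "v \<in> Y" "v \<notin> C" using CX CY by blast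
    \<comment> \<open>A common vector outside \<open>C\<close> would span with \<open>C\<close> a
      space of the rank of \<open>X\<close> and \<open>Y\<close>, forcing both to equal it.\<close>
    have "vec.span (insert v C) \<subseteq> X" "vec.span (insert v C) \<subseteq> Y"
      using v CX CY sub[OF X] sub[OF Y] by (simp_all add: vec.span_minimal)
    then have "vec.span (insert v C) = X" "vec.span (insert v C) = Y"
      using antichain[OF extend[OF C v(3)]] X Y by simp_all
    then show False using neq by simp
  qed
  show "\<exists>Z\<in>?G (Suc (Suc k)). X \<subseteq> Z \<and> Y \<subseteq> Z \<and> (\<forall>l. \<forall>W\<in>?G l. X \<subseteq> W \<longrightarrow> Y \<subseteq> W \<longrightarrow> Z \<subseteq> W)"
    if X: "X \<in> ?G (Suc k)" and Y: "Y \<in> ?G (Suc k)" and neq: "X \<noteq> Y" and XY: "X \<inter> Y \<in> ?G k"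
    for X Y k
  proof -
    have "\<not> Y \<subseteq> X" using antichain[OF Y X] neq by blast
    then obtain v where v: "v \<in> Y" "v \<notin> X" by blast
    \<comment> \<open>By dimension \<open>Y\<close> is generated by \<open>X \<inter> Y\<close> and
      \<open>v\<close>, so adjoining \<open>v\<close> to \<open>X\<close> already captures all of
      \<open>Y\<close>.\<close>
    have "vec.span (insert v (X \<inter> Y)) \<subseteq> Y"
      using v sub[OF Y] by (intro vec.span_minimal) auto
    then have "vec.span (insert v (X \<inter> Y)) = Y"
      using antichain[OF extend[OF XY] Y] v by simp
    then have "Y \<subseteq> vec.span (insert v X)"
      using vec.span_mono[of "insert v (X \<inter> Y)" "insert v X"] by auto
    moreover have "X \<subseteq> vec.span (insert v X)"
      using vec.span_superset[of "insert v X"] by auto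
    moreover have "vec.span (insert v X) \<subseteq> W" if "W \<in> ?G l" "X \<subseteq> W" "Y \<subseteq> W" for l W
      using that v sub by (intro vec.span_minimal) auto
    ultimately show ?thesis
      by (intro bexI[OF _ extend[OF X v(2)]] conjI allI ballI impI)
  qed
  show "X \<inter> Y \<in> ?G k" if X: "X \<in> ?G (Suc k)" and Y: "Y \<in> ?G (Suc k)" and neq: "X \<noteq> Y"
    and Z: "Z \<in> ?G (Suc (Suc k))" and XZ: "X \<subseteq> Z" and YZ: "Y \<subseteq> Z" for X Y Z k
  proof -
    have "\<not> Y \<subseteq> X" using antichain[OF Y X] neq by blast
    then obtain v where v: "v \<in> Y" "v \<notin> X" by blast
    \<comment> \<open>The sum X + Y lies between \<open>vec.span (insert v X)\<close> and
      \<open>Z\<close>, which coincide by dimension. The dimension formula then gives 2(k+1) - (k+2)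
      = k.\<close>
    let ?ST = "{x + y |x y. x \<in> X \<and> y \<in> Y}"
    have "vec.span (insert v X) \<subseteq> ?ST"
    proof (rule vec.span_minimal)
      have "0 \<in> X" "0 \<in> Y"
        using vec.subspace_0 sub[OF X] sub[OF Y] by auto
      show "insert v X \<subseteq> ?ST"
      proof
        fix y assume "y \<in> insert v X"
        then obtain a b where "a \<in> X" "b \<in> Y" "y = a + b"
          using \<open>0 \<in> X\<close> \<open>0 \<in> Y\<close> v(1) by (metis add.left_neutral add.right_neutral insert_iff)
        then show "y \<in> ?ST" by blast
      qed
      show "vec.subspace ?ST" using sub[OF X] sub[OF Y] by (rule vec.subspace_sums)
    qed
    moreover have "vec.span (insert v X) \<subseteq> Z"
      using v XZ YZ sub[OF Z] by (intro vec.span_minimal) auto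
    then have "vec.span (insert v X) = Z"
      using antichain[OF extend[OF X v(2)] Z] by simp
    moreover have "?ST \<subseteq> Z"
      using XZ YZ by (clarify; intro vec.subspace_add[OF sub[OF Z]]; blast)
    ultimately have ST: "?ST = Z" by (simp only: subset_antisym)
    have "vec.dim (X \<inter> Y) = k"
      using vec.dim_sums_Int[OF sub[OF X] sub[OF Y], unfolded ST] dim[OF X] dim[OF Y] dim[OF Z]
      by simp
    then show ?thesis
      using vec.subspace_inter[OF sub[OF X] sub[OF Y]] by (simp add: subspaces_def)
  qed
qed simp_all

text \<open>The first half is q = 1, the second q = \<open>CARD('f)\<close>. The bounds on n and k
  exclude graphs with a single vertex, such as J_q(n,n) or the block graph for n = 3, where there is
  no second eigenvalue.\<close>

theorem theorem3:
  fixes n :: nat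
    and G\<^sub>1 :: "nat \<Rightarrow> nat set set"
    and G\<^sub>q :: "nat \<Rightarrow> ('f::{field,finite} ^ 'n::finite) set set"
  assumes "G\<^sub>1 = subsets n" and "G\<^sub>q = subspaces"
  shows
    "((2 \<le> n \<longrightarrow>
        U G\<^sub>1 = {zero_vec (verts (J G\<^sub>1 1))} \<union> {v. eigenvector (J G\<^sub>1 1) (theta 1 (J G\<^sub>1 1)) v}) \<and>
      (\<forall>k. 1 \<le> k \<and> k < n \<longrightarrow>
        WT G\<^sub>1 (verts (J G\<^sub>1 k)) ` U G\<^sub>1 =
          {zero_vec (verts (J G\<^sub>1 k))} \<union> {v. eigenvector (J G\<^sub>1 k) (theta 1 (J G\<^sub>1 k)) v}) \<and>
      (\<forall>S. STS G\<^sub>1 S \<and> 3 < n \<longrightarrow>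
        WT G\<^sub>1 S ` U G\<^sub>1 =
          {zero_vec S} \<union> {v. eigenvector (block_graph G\<^sub>1 S) (theta 1 (block_graph G\<^sub>1 S)) v} \<and>
        (\<forall>v. eigenvector (J G\<^sub>1 3) (theta 1 (J G\<^sub>1 3)) v \<longrightarrow>
           eigenvector (block_graph G\<^sub>1 S) (theta 1 (block_graph G\<^sub>1 S)) (restrict v S)) \<and>
        (\<forall>w. eigenvector (block_graph G\<^sub>1 S) (theta 1 (block_graph G\<^sub>1 S)) w \<longrightarrow>
           (\<exists>!v. eigenvector (J G\<^sub>1 3) (theta 1 (J G\<^sub>1 3)) v \<and> restrict v S = w)) \<and>
        m 1 (block_graph G\<^sub>1 S) \<le> m 1 (J G\<^sub>1 3))) \<and>
     ((2 \<le> CARD('n) \<longrightarrow>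
        U G\<^sub>q = {zero_vec (verts (J G\<^sub>q 1))} \<union> {v. eigenvector (J G\<^sub>q 1) (theta 1 (J G\<^sub>q 1)) v}) \<and>
      (\<forall>k. 1 \<le> k \<and> k < CARD('n) \<longrightarrow>
        WT G\<^sub>q (verts (J G\<^sub>q k)) ` U G\<^sub>q =
          {zero_vec (verts (J G\<^sub>q k))} \<union> {v. eigenvector (J G\<^sub>q k) (theta 1 (J G\<^sub>q k)) v}) \<and>
      (\<forall>S. STS G\<^sub>q S \<and> 3 < CARD('n) \<longrightarrow>
        WT G\<^sub>q S ` U G\<^sub>q =
          {zero_vec S} \<union> {v. eigenvector (block_graph G\<^sub>q S) (theta 1 (block_graph G\<^sub>q S)) v} \<and>
        (\<forall>v. eigenvector (J G\<^sub>q 3) (theta 1 (J G\<^sub>q 3)) v \<longrightarrow>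
           eigenvector (block_graph G\<^sub>q S) (theta 1 (block_graph G\<^sub>q S)) (restrict v S)) \<and>
        (\<forall>w. eigenvector (block_graph G\<^sub>q S) (theta 1 (block_graph G\<^sub>q S)) w \<longrightarrow>
           (\<exists>!v. eigenvector (J G\<^sub>q 3) (theta 1 (J G\<^sub>q 3)) v \<and> restrict v S = w)) \<and>
        m 1 (block_graph G\<^sub>q S) \<le> m 1 (J G\<^sub>q 3)))"
proof -
  interpret johnson: geometry G\<^sub>1 n 1 "{}" "{1..n}"
    unfolding assms by (rule geometry_subsets)
  interpret grassmann: geometry G\<^sub>q "CARD('n)" "CARD('f)" "{0}" UNIV
    unfolding assms by (rule geometry_subspaces)
  show ?thesis
    by (intro conjI allI impI; (elim conjE)?)
      (assumption | rule
        johnson.U_eq_eigenspace johnson.WT_image_J johnson.WT_image_block_graph johnson.eigenvector_restrict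
        johnson.eigenvector_extends johnson.m_block_graph_le
        grassmann.U_eq_eigenspace grassmann.WT_image_J grassmann.WT_image_block_graph
        grassmann.eigenvector_restrict grassmann.eigenvector_extends grassmann.m_block_graph_le)+
qed

end
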